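(* Let $V$ be a valuation domain with quotient field $K$ whose maximal ideal $M$ is not finitely generated and whose residue field $V/M$ is infinite. Let $\alpha\in K$, $c\in K\setminus\{0\}$, $\delta=v(c)$. Let $E\subset K$ be a pseudo-convergent sequence and $F\subset K$ a pseudo-stationary sequence with $\mathcal L_E=\mathcal L_F=\alpha+cV=B(\alpha,\delta)$ and, for every $z\in B(\alpha,\delta)$, let $D_z\subset K$ be a pseudo-divergent sequence with $\mathcal L_{D_z}=z+cM$. Let $z,w\in B(\alpha,\delta)$. Then $V_F$ properly contains both $V_E$ and $V_{D_z}$; $V_E\neq V_{D_z}$; and $V_{D_z}=V_{D_w}$ if and only if $z-w\in cM$.
   Context: $v$ denotes the valuation of $V$ and $\Gamma_v$ its value group. For $\alpha\in K$ and $\delta\in\Gamma_v$, $B(\alpha,\delta)=\{x\in K\mid v(\alpha-x)\geq\delta\}$. Sequences $E=\{s_\nu\}_{\nu\in\Lambda}\subset K$ are indexed by well-ordered sets $\Lambda$ without maximum. $E$ is pseudo-convergent if $v(s_\rho-s_\nu)<v(s_\sigma-s_\rho)$ for all $\nu<\rho<\sigma$; pseudo-divergent if $v(s_\rho-s_\nu)>v(s_\sigma-s_\rho)$ for all $\nu<\rho<\sigma$; pseudo-stationary if $v(s_\nu-s_\mu)=v(s_{\nu'}-s_{\mu'})$ for all $\nu\ne\mu$, $\nu'\neq\mu'$; pseudo-monotone if it is one of these three. The gauge $\{\delta_\nu\}$ of $E$ is: $\delta_\nu=v(s_\rho-s_\nu)$ for any $\rho>\nu$ if $E$ is pseudo-convergent;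 $\delta_\nu=v(s_\rho-s_\nu)$ for any $\rho<\nu$ ($\nu$ not the minimum of $\Lambda$) if $E$ is pseudo-divergent; the constant $\delta_\nu=v(s_\rho-s_\mu)$, $\rho\neq\mu$, if $E$ is pseudo-stationary. An element $\alpha\in K$ is a pseudo-limit of $E$ if $v(\alpha-s_\nu)=\delta_\nu$ for all sufficiently large $\nu$; $\mathcal L_E$ is the set of pseudo-limits of $E$ in $K$. For a pseudo-monotone $E$, $V_E=\{\phi\in K(X)\mid \phi(s_\nu)\in V\text{ for all sufficiently large }\nu\in\Lambda\}$, a valuation domain of $K(X)$. (Under the hypotheses of the statement, sequences $E$, $F$, $D_z$ as described exist.) *)

theory Defs
  imports
    "HOL-Library.Extended"
    "HOL-Computational_Algebra.Polynomial"
    "HOL-Computational_Algebra.Fraction_Field"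
begin

text \<open>
  The quotient field \<open>K\<close> is a type of class \<open>field\<close>, and \<open>V\<close> is a subset of it. The second
  condition on \<open>V\<close> entails that \<open>K\<close> is the field of fractions of \<open>V\<close>.
\<close>

definition subring_of_field :: "'k::field set \<Rightarrow> bool" where
  "subring_of_field V \<longleftrightarrow>
     1 \<in> V \<and> (\<forall>x\<in>V. \<forall>y\<in>V. x - y \<in> V) \<and> (\<forall>x\<in>V. \<forall>y\<in>V. x * y \<in> V)"

definition valuation_domain :: "'k::field set \<Rightarrow> bool" where
  "valuation_domain V \<longleftrightarrow> subring_of_field V \<and> (\<forall>x. x \<noteq> 0 \<longrightarrow> x \<in> V \<or> inverse x \<in> V)"

text \<open>The non-units of \<open>V\<close>; for a valuation domain this is its unique maximal ideal.\<close>

definition max_ideal :: "'k::field set \<Rightarrow> 'k set" where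
  "max_ideal V = {x \<in> V. \<not> (\<exists>y\<in>V. x * y = 1)}"

definition ideal_generated :: "'k::field set \<Rightarrow> 'k set \<Rightarrow> 'k set" where
  "ideal_generated V S = {(\<Sum>s\<in>T. a s * s) | T a. finite T \<and> T \<subseteq> S \<and> a ` T \<subseteq> V}"

definition finitely_generated_ideal :: "'k::field set \<Rightarrow> 'k set \<Rightarrow> bool" where
  "finitely_generated_ideal V I \<longleftrightarrow> (\<exists>S. finite S \<and> S \<subseteq> V \<and> I = ideal_generated V S)"

definition residue_field :: "'k::field set \<Rightarrow> 'k set set" where
  "residue_field V = V // {(x, y). x \<in> V \<and> y \<in> V \<and> x - y \<in> max_ideal V}"

text \<open>
  \<open>v\<close> is the (additively written, Krull) valuation of \<open>V\<close>, with value group the whole of the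
  type \<open>'g\<close>, and with \<open>v 0 = \<infinity>\<close>. The value \<open>-\<infinity>\<close> of the type \<open>extended\<close> is never taken.
\<close>

definition valuation_of :: "'k::field set \<Rightarrow> ('k \<Rightarrow> 'g::linordered_ab_group_add extended) \<Rightarrow> bool" where
  "valuation_of V v \<longleftrightarrow>
     v 0 = Pinf \<and> v ` (UNIV - {0}) = range Fin \<and>
     (\<forall>x y. v (x * y) = v x + v y) \<and>
     (\<forall>x y. min (v x) (v y) \<le> v (x + y)) \<and>
     V = {x. 0 \<le> v x}"

definition vball :: "('k::field \<Rightarrow> 'g::linordered_ab_group_add extended) \<Rightarrow> 'k \<Rightarrow> 'g \<Rightarrow> 'k set" where
  "vball v \<alpha> \<delta> = {x. Fin \<delta> \<le> v (\<alpha> - x)}"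

text \<open>\<open>scaled c S\<close> is \<open>cS\<close>, and \<open>affine \<alpha> c S\<close> is \<open>\<alpha> + cS\<close>.\<close>

definition scaled :: "'k::field \<Rightarrow> 'k set \<Rightarrow> 'k set" where
  "scaled c S = (\<lambda>x. c * x) ` S"

definition affine :: "'k::field \<Rightarrow> 'k \<Rightarrow> 'k set \<Rightarrow> 'k set" where
  "affine \<alpha> c S = (\<lambda>x. \<alpha> + x) ` scaled c S"

lemma affine_eq_vball:
  assumes v: "valuation_of V v" and c: "v c = Fin \<delta>"
  shows "affine \<alpha> c V = vball v \<alpha> \<delta>"
proof -
  have mult: "\<And>x y. v (x * y) = v x + v y" and V: "V = {x. 0 \<le> v x}" and v0: "v 0 = Pinf"
    and fin: "v ` (UNIV - {0}) = range Fin"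
    using v by (auto simp: valuation_of_def)
  have finE: "\<exists>a. v x = Fin a" if "x \<noteq> 0" for x
    using fin that by blast
  have c0: "c \<noteq> 0"
    using c v0 by auto
  obtain e where e: "v (-1) = Fin e"
    using finE[of "-1"] by auto
  obtain u where u: "v 1 = Fin u"
    using finE[of 1] by auto
  have "u = u + u"
    using mult[of 1 1] u by simp
  moreover have "e + e = u"
    using mult[of "-1" "-1"] e u by simp
  ultimately have e0: "e = 0"
    by (simp add: double_zero)
  have neg: "v (- x) = v x" for x
    using mult[of "-1" x] e e0 by (cases "v x") auto
  have cV: "Fin \<delta> \<le> v (c * x) \<longleftrightarrow> 0 \<le> v x" for x
    by (cases "v x") (auto simp: mult c zero_extended_def)
  show ?thesis
  proof (intro equalityI subsetI)
    fix y assume "y \<in> affine \<alpha> c V"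
    then obtain x where "0 \<le> v x" "y = \<alpha> + c * x"
      by (auto simp: affine_def scaled_def V)
    then show "y \<in> vball v \<alpha> \<delta>"
      using cV[of x] neg[of "c * x"] by (simp add: vball_def)
  next
    fix y assume "y \<in> vball v \<alpha> \<delta>"
    then have "Fin \<delta> \<le> v (c * ((y - \<alpha>) / c))"
      using c0 neg[of "y - \<alpha>"] by (simp add: vball_def)
    then have "(y - \<alpha>) / c \<in> V"
      unfolding cV V by blast
    moreover have "y = \<alpha> + c * ((y - \<alpha>) / c)"
      using c0 by simp
    ultimately show "y \<in> affine \<alpha> c V"
      unfolding affine_def scaled_def by blast
  qed
qed

text \<open>
  A sequence is a function \<open>s\<close> restricted to an index set \<open>\<Lambda>\<close>, a nonempty subset without maximum
  of a well-ordered type. Every well-ordered set, and every family of such, is order-isomorphic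
  to a subset (a family of subsets) of a single well-order.
\<close>

definition index_set :: "'i::wellorder set \<Rightarrow> bool" where
  "index_set \<Lambda> \<longleftrightarrow> \<Lambda> \<noteq> {} \<and> (\<forall>\<nu>\<in>\<Lambda>. \<exists>\<rho>\<in>\<Lambda>. \<nu> < \<rho>)"

definition suff_large :: "'i::wellorder set \<Rightarrow> ('i \<Rightarrow> bool) \<Rightarrow> bool" where
  "suff_large \<Lambda> P \<longleftrightarrow> (\<exists>\<nu>\<^sub>0\<in>\<Lambda>. \<forall>\<nu>\<in>\<Lambda>. \<nu>\<^sub>0 \<le> \<nu> \<longrightarrow> P \<nu>)"

definition pseudo_convergent ::
  "('k::field \<Rightarrow> 'g::linordered_ab_group_add extended) \<Rightarrow> 'i::wellorder set \<Rightarrow> ('i \<Rightarrow> 'k) \<Rightarrow> bool" where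
  "pseudo_convergent v \<Lambda> s \<longleftrightarrow> index_set \<Lambda> \<and>
     (\<forall>\<nu>\<in>\<Lambda>. \<forall>\<rho>\<in>\<Lambda>. \<forall>\<sigma>\<in>\<Lambda>. \<nu> < \<rho> \<and> \<rho> < \<sigma> \<longrightarrow> v (s \<rho> - s \<nu>) < v (s \<sigma> - s \<rho>))"

definition pseudo_divergent ::
  "('k::field \<Rightarrow> 'g::linordered_ab_group_add extended) \<Rightarrow> 'i::wellorder set \<Rightarrow> ('i \<Rightarrow> 'k) \<Rightarrow> bool" where
  "pseudo_divergent v \<Lambda> s \<longleftrightarrow> index_set \<Lambda> \<and>
     (\<forall>\<nu>\<in>\<Lambda>. \<forall>\<rho>\<in>\<Lambda>. \<forall>\<sigma>\<in>\<Lambda>. \<nu> < \<rho> \<and> \<rho> < \<sigma> \<longrightarrow> v (s \<rho> - s \<nu>) > v (s \<sigma> - s \<rho>))"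

definition pseudo_stationary ::
  "('k::field \<Rightarrow> 'g::linordered_ab_group_add extended) \<Rightarrow> 'i::wellorder set \<Rightarrow> ('i \<Rightarrow> 'k) \<Rightarrow> bool" where
  "pseudo_stationary v \<Lambda> s \<longleftrightarrow> index_set \<Lambda> \<and>
     (\<forall>\<nu>\<in>\<Lambda>. \<forall>\<mu>\<in>\<Lambda>. \<forall>\<nu>'\<in>\<Lambda>. \<forall>\<mu>'\<in>\<Lambda>. \<nu> \<noteq> \<mu> \<and> \<nu>' \<noteq> \<mu>' \<longrightarrow> v (s \<nu> - s \<mu>) = v (s \<nu>' - s \<mu>'))"

text \<open>
  The three kinds of sequence exclude each other, and in each case the described value does not
  depend on the choice of indices. It is unspecified in the pseudo-divergent case for the minimum
  of \<open>\<Lambda>\<close>, and for sequences that are not pseudo-monotone.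
\<close>

definition gauge ::
  "('k::field \<Rightarrow> 'g::linordered_ab_group_add extended) \<Rightarrow> 'i::wellorder set \<Rightarrow> ('i \<Rightarrow> 'k) \<Rightarrow> 'i \<Rightarrow> 'g extended" where
  "gauge v \<Lambda> s \<nu> =
     (if pseudo_convergent v \<Lambda> s then THE \<delta>. \<forall>\<rho>\<in>\<Lambda>. \<nu> < \<rho> \<longrightarrow> v (s \<rho> - s \<nu>) = \<delta>
      else if pseudo_divergent v \<Lambda> s then THE \<delta>. \<forall>\<rho>\<in>\<Lambda>. \<rho> < \<nu> \<longrightarrow> v (s \<rho> - s \<nu>) = \<delta>
      else if pseudo_stationary v \<Lambda> s then THE \<delta>. \<forall>\<rho>\<in>\<Lambda>. \<forall>\<mu>\<in>\<Lambda>. \<rho> \<noteq> \<mu> \<longrightarrow> v (s \<rho> - s \<mu>) = \<delta>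
      else undefined)"

definition pseudo_limits ::
  "('k::field \<Rightarrow> 'g::linordered_ab_group_add extended) \<Rightarrow> 'i::wellorder set \<Rightarrow> ('i \<Rightarrow> 'k) \<Rightarrow> 'k set" where
  "pseudo_limits v \<Lambda> s = {\<alpha>. suff_large \<Lambda> (\<lambda>\<nu>. v (\<alpha> - s \<nu>) = gauge v \<Lambda> s \<nu>)}"

text \<open>
  The field \<open>K(X)\<close> is the type \<open>'k poly fract\<close>. Evaluation is partial: \<open>rat_value \<phi> a y\<close> states
  that \<open>\<phi>\<close> has no pole at \<open>a\<close> and \<open>\<phi>(a) = y\<close>.
\<close>

definition rat_value :: "'k::field poly fract \<Rightarrow> 'k \<Rightarrow> 'k \<Rightarrow> bool" where
  "rat_value \<phi> a y \<longleftrightarrow> (\<exists>p q. \<phi> = Fract p q \<and> poly q a \<noteq> 0 \<and> y = poly p a / poly q a)"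

lemma rat_value_unique:
  assumes "rat_value \<phi> a y" "rat_value \<phi> a y'"
  shows "y = y'"
proof -
  obtain p q p' q' where *: "\<phi> = Fract p q" "poly q a \<noteq> 0" "y = poly p a / poly q a"
    "\<phi> = Fract p' q'" "poly q' a \<noteq> 0" "y' = poly p' a / poly q' a"
    using assms unfolding rat_value_def by blast
  then have "p * q' = p' * q"
    by (metis eq_fract(1) poly_0)
  then have "poly p a * poly q' a = poly p' a * poly q a"
    by (metis poly_mult)
  with * show ?thesis
    by (simp add: frac_eq_eq)
qed

definition seq_ring :: "'k::field set \<Rightarrow> 'i::wellorder set \<Rightarrow> ('i \<Rightarrow> 'k) \<Rightarrow> 'k poly fract set" where
  "seq_ring V \<Lambda> s = {\<phi>. suff_large \<Lambda> (\<lambda>\<nu>. \<exists>y\<in>V. rat_value \<phi> (s \<nu>) y)}"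

end

theory Submission
  imports Defs
begin

text \<open>
  Expand \<open>p \<in> K[X]\<close> as \<open>\<Sum> a\<^sub>i (X - \<beta>)\<^sup>i\<close> with \<open>\<beta>\<close> a pseudo-limit of the sequence \<open>s\<close>. Eventually
  \<open>v (p (s\<^sub>\<nu>))\<close> is the least of the values \<open>v (a\<^sub>i (s\<^sub>\<nu> - \<beta>)\<^sup>i)\<close>: in the strictly monotone cases because
  two monomials tie for at most one value of \<open>v (s\<^sub>\<nu> - \<beta>)\<close>, in the stationary case because a nonzero
  polynomial over the residue field has finitely many roots. Hence whether \<open>p / q\<close> lies in the
  ring of \<open>s\<close> depends only on finitely many comparisons of monomials at \<open>v (s\<^sub>\<nu> - \<beta>)\<close>. These
  values tend to \<open>\<delta>\<close>, from below for \<open>E\<close> and from above for \<open>D\<^sub>z\<close>, and are constantly \<open>\<delta>\<close> for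
  \<open>F\<close>. Since the value group has no least positive element, a strict inequality between monomials
  at \<open>\<delta>\<close> persists near \<open>\<delta>\<close>, which gives both inclusions; and every comparison is eventually
  constant as the value decreases to \<open>\<delta>\<close>, so the ring of \<open>D\<^sub>z\<close> depends only on \<open>z + cM\<close>.
  The rings are told apart by \<open>(X - \<alpha>) / c\<close> and \<open>c / (X - z)\<close>.
\<close>

section \<open>Filters of tails\<close>

text \<open>A filter in place of \<open>suff_large\<close>, so that finitely many eventual
  statements combine by the general rules for \<open>eventually\<close>.\<close>

definition tail_filter :: "'i::wellorder set \<Rightarrow> 'i filter" where
  "tail_filter \<Lambda> = (INF \<nu>\<in>\<Lambda>. principal (\<Lambda> \<inter> {\<nu>..}))"

text \<open>Pushing the tails forward to \<open>K\<close> forgets the indices: sequences over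
  different well-orders become comparable through the order on filters.\<close>

definition increments :: "'i::wellorder set \<Rightarrow> ('i \<Rightarrow> 'k::field) \<Rightarrow> 'k \<Rightarrow> 'k filter" where
  "increments \<Lambda> s \<beta> = filtermap (\<lambda>\<nu>. s \<nu> - \<beta>) (tail_filter \<Lambda>)"

lemma eventually_tail_filter:
  assumes "\<Lambda> \<noteq> {}"
  shows "eventually P (tail_filter \<Lambda>) \<longleftrightarrow> suff_large \<Lambda> P"
proof -
  have "eventually P (tail_filter \<Lambda>) \<longleftrightarrow> (\<exists>\<nu>\<in>\<Lambda>. eventually P (principal (\<Lambda> \<inter> {\<nu>..})))"
    unfolding tail_filter_def
  proof (rule eventually_INF_base[OF assms])
    fix a b assume "a \<in> \<Lambda>" "b \<in> \<Lambda>"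
    then show "\<exists>x\<in>\<Lambda>. principal (\<Lambda> \<inter> {x..}) \<le> inf (principal (\<Lambda> \<inter> {a..})) (principal (\<Lambda> \<inter> {b..}))"
      by (intro bexI[of _ "max a b"]) (auto simp: max_def)
  qed
  then show ?thesis
    by (auto simp: suff_large_def eventually_principal)
qed

lemma eventually_tail_filter_gt:
  assumes "index_set \<Lambda>" "\<nu> \<in> \<Lambda>"
  shows "\<forall>\<^sub>F \<rho> in tail_filter \<Lambda>. \<rho> \<in> \<Lambda> \<and> \<nu> < \<rho>"
proof -
  have "\<Lambda> \<noteq> {}" and "\<exists>\<rho>\<in>\<Lambda>. \<nu> < \<rho>"
    using assms by (auto simp: index_set_def)
  then show ?thesis
    by (auto simp: eventually_tail_filter suff_large_def intro: less_le_trans)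
qed

lemma tail_filter_neq_bot: "index_set \<Lambda> \<Longrightarrow> tail_filter \<Lambda> \<noteq> bot"
  unfolding trivial_limit_def
  by (auto simp: eventually_tail_filter index_set_def suff_large_def)

lemma eventually_increments:
  "index_set \<Lambda> \<Longrightarrow> eventually P (increments \<Lambda> s \<beta>) \<longleftrightarrow> suff_large \<Lambda> (\<lambda>\<nu>. P (s \<nu> - \<beta>))"
  by (simp add: increments_def eventually_filtermap eventually_tail_filter index_set_def)

lemma increments_neq_bot: "index_set \<Lambda> \<Longrightarrow> increments \<Lambda> s \<beta> \<noteq> bot"
  by (simp add: increments_def tail_filter_neq_bot filtermap_bot_iff)

text \<open>Finitely many tails intersect in a tail, and a single conjunct that eventually fails
  refutes the whole conjunction.\<close>

lemma eventually_decided_ball: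
  assumes "finite S"
    and "\<And>s. s \<in> S \<Longrightarrow> (\<forall>\<^sub>F x in G. P s x) \<or> (\<forall>\<^sub>F x in G. \<not> P s x)"
  shows "(\<forall>\<^sub>F x in G. \<forall>s\<in>S. P s x) \<or> (\<forall>\<^sub>F x in G. \<not> (\<forall>s\<in>S. P s x))"
proof (cases "\<forall>s\<in>S. \<forall>\<^sub>F x in G. P s x")
  case True
  with assms(1) show ?thesis by (simp add: eventually_ball_finite)
next
  case False
  then obtain s where s: "s \<in> S" "\<forall>\<^sub>F x in G. \<not> P s x"
    using assms(2) by blast
  from s(2) have "\<forall>\<^sub>F x in G. \<not> (\<forall>s\<in>S. P s x)"
    by (rule eventually_mono) (use s(1) in blast)
  then show ?thesis ..
qed

lemma eventually_decided_bex:
  assumes "finite S"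
    and "\<And>s. s \<in> S \<Longrightarrow> (\<forall>\<^sub>F x in G. P s x) \<or> (\<forall>\<^sub>F x in G. \<not> P s x)"
  shows "(\<forall>\<^sub>F x in G. \<exists>s\<in>S. P s x) \<or> (\<forall>\<^sub>F x in G. \<not> (\<exists>s\<in>S. P s x))"
  using eventually_decided_ball[of S "\<lambda>s x. \<not> P s x" G] assms by auto

lemma increments_not_eventually:
  assumes "index_set \<Lambda>" "\<forall>\<^sub>F x in increments \<Lambda> s \<beta>. \<not> P x"
  shows "\<not> eventually P (increments \<Lambda> s \<beta>)"
proof
  assume "eventually P (increments \<Lambda> s \<beta>)"
  with assms(2) have "\<forall>\<^sub>F x in increments \<Lambda> s \<beta>. False"
    by eventually_elim simp
  with increments_neq_bot[OF assms(1), of s \<beta>] show False by simp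
qed

text \<open>Change of centre: \<open>s \<nu> - \<beta> = (s \<nu> - \<gamma>) + (\<gamma> -
  \<beta>)\<close>.\<close>

lemma eventually_increments_shift:
  "eventually P (increments \<Lambda> s \<beta>) \<longleftrightarrow> (\<forall>\<^sub>F x in increments \<Lambda> s \<gamma>. P (x + (\<gamma> - \<beta>)))"
  by (simp add: increments_def eventually_filtermap)

section \<open>Valuations\<close>

locale valued_field =
  fixes V :: "'k::field set" and v :: "'k \<Rightarrow> 'g::linordered_ab_group_add extended"
  assumes val: "valuation_of V v"
begin

lemma v_zero [simp]: "v 0 = Pinf"
  and v_mult: "v (x * y) = v x + v y"
  and v_add: "min (v x) (v y) \<le> v (x + y)"
  and V_eq: "V = {x. 0 \<le> v x}"
  using val by (auto simp: valuation_of_def)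

lemma v_finE:
  assumes "x \<noteq> 0"
  obtains a where "v x = Fin a"
  using val assms unfolding valuation_of_def by blast

lemma v_not_Minf [simp]: "v x \<noteq> Minf"
  by (cases "x = 0") (auto elim: v_finE)

lemma v_eq_Pinf [simp]: "v x = Pinf \<longleftrightarrow> x = 0"
  by (cases "x = 0") (auto elim: v_finE)

lemma v_less_Pinf [simp]: "v x < Pinf \<longleftrightarrow> x \<noteq> 0"
  by (cases "x = 0") (auto elim: v_finE)

lemma Pinf_le_v [simp]: "Pinf \<le> v x \<longleftrightarrow> x = 0"
  by (cases "x = 0") (auto elim: v_finE)

lemma v_le_Pinf [simp]: "v x \<le> Pinf"
  by (cases "v x") auto

lemma v_one: "v 1 = 0"
proof -
  obtain u where u: "v 1 = Fin u"
    using v_finE[of 1] by auto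
  have "u = u + u"
    using v_mult[of 1 1] u by simp
  then show ?thesis
    using u by (simp add: zero_extended_def)
qed

text \<open>With \<open>v 1\<close> in place of \<open>0\<close>, every estimate compares two values
  of \<open>v\<close> and the cancellation rules apply.\<close>

lemma V_iff: "x \<in> V \<longleftrightarrow> v 1 \<le> v x"
  by (simp add: V_eq v_one)

lemma v_minus [simp]: "v (- x) = v x"
proof -
  obtain e where e: "v (-1) = Fin e"
    using v_finE[of "-1"] by auto
  have "e + e = 0"
    using v_mult[of "-1" "-1"] e v_one by (simp add: zero_extended_def)
  then have "e = 0" by (simp add: double_zero)
  then show ?thesis
    using v_mult[of "-1" x] e by (cases "v x") auto
qed

lemma v_minus_commute: "v (x - y) = v (y - x)"
  using v_minus[of "x - y"] by simp

lemma v_mult_cancel_le [simp]: "a \<noteq> 0 \<Longrightarrow> v (a * x) \<le> v (a * y) \<longleftrightarrow> v x \<le> v y"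
  by (erule v_finE, cases "v x"; cases "v y") (auto simp: v_mult)

lemma v_mult_cancel_less [simp]: "a \<noteq> 0 \<Longrightarrow> v (a * x) < v (a * y) \<longleftrightarrow> v x < v y"
  by (meson not_le v_mult_cancel_le)

lemma v_mult_cancel_eq [simp]: "a \<noteq> 0 \<Longrightarrow> v (a * x) = v (a * y) \<longleftrightarrow> v x = v y"
  by (simp add: order_eq_iff)

lemma v_mult_mono: "v x \<le> v y \<Longrightarrow> v a \<le> v b \<Longrightarrow> v (x * a) \<le> v (y * b)"
  by (cases "v x"; cases "v y"; cases "v a"; cases "v b") (auto simp: v_mult add_mono)

lemma v_mult_strict: "v x < v y \<Longrightarrow> v a \<le> v b \<Longrightarrow> a \<noteq> 0 \<Longrightarrow> v (x * a) < v (y * b)"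
  by (erule v_finE, cases "v x"; cases "v y"; cases "v b") (auto simp: v_mult add_less_le_mono)

lemma v_power_mono: "v x \<le> v y \<Longrightarrow> v (x ^ n) \<le> v (y ^ n)"
  by (induction n) (auto intro: v_mult_mono)

lemma v_power_strict:
  assumes "v x < v y" "x \<noteq> 0" "0 < n"
  shows "v (x ^ n) < v (y ^ n)"
proof -
  obtain m where "n = Suc m" using assms(3) gr0_implies_Suc by blast
  then show ?thesis
    using assms by (auto intro!: v_mult_strict v_power_mono)
qed

lemma v_power_eq: "v x = v y \<Longrightarrow> v (x ^ n) = v (y ^ n)"
  by (simp add: order_eq_iff v_power_mono)

lemma v_power_inject:
  assumes "v (x ^ n) = v (y ^ n)" "x \<noteq> 0" "y \<noteq> 0" "0 < n"
  shows "v x = v y"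
  using assms v_power_strict[of x y n] v_power_strict[of y x n] by (cases "v x" "v y" rule: linorder_cases) auto

lemma v_add_ge: "t \<le> v x \<Longrightarrow> t \<le> v y \<Longrightarrow> t \<le> v (x + y)"
  by (meson min.boundedI order_trans v_add)

lemma v_diff_ge: "t \<le> v x \<Longrightarrow> t \<le> v y \<Longrightarrow> t \<le> v (x - y)"
  using v_add_ge[of t x "- y"] by simp

lemma v_add_gt: "t < v x \<Longrightarrow> t < v y \<Longrightarrow> t < v (x + y)"
  by (meson min_less_iff_conj less_le_trans v_add)

lemma v_diff_gt: "t < v x \<Longrightarrow> t < v y \<Longrightarrow> t < v (x - y)"
  using v_add_gt[of t x "- y"] by simp

lemma v_add_eq: "v x < v y \<Longrightarrow> v (x + y) = v x"
proof (rule order_antisym)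
  assume "v x < v y"
  then show "v x \<le> v (x + y)" by (simp add: v_add_ge)
  show "v (x + y) \<le> v x"
    using v_diff_gt[of "v x" "x + y" y] \<open>v x < v y\<close> by (auto simp flip: not_less)
qed

lemma v_sum_ge: "(\<And>i. i \<in> A \<Longrightarrow> t \<le> v (f i)) \<Longrightarrow> t \<le> Pinf \<Longrightarrow> t \<le> v (sum f A)"
  by (induction A rule: infinite_finite_induct) (auto intro: v_add_ge)

lemma v_sum_gt: "(\<And>i. i \<in> A \<Longrightarrow> t < v (f i)) \<Longrightarrow> t < Pinf \<Longrightarrow> t < v (sum f A)"
  by (induction A rule: infinite_finite_induct) (auto intro: v_add_gt)

lemma max_ideal_iff: "x \<in> max_ideal V \<longleftrightarrow> v 1 < v x"
proof (cases "x = 0")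
  case True
  then show ?thesis by (simp add: max_ideal_def V_iff)
next
  case False
  then have "(\<exists>y\<in>V. x * y = 1) \<longleftrightarrow> inverse x \<in> V"
    by (metis inverse_unique right_inverse)
  also have "\<dots> \<longleftrightarrow> v x \<le> v 1"
    using False v_mult_cancel_le[of x 1 "inverse x"] by (simp add: V_iff)
  finally show ?thesis
    by (auto simp: max_ideal_def V_iff)
qed

lemma affine_iff: "c \<noteq> 0 \<Longrightarrow> x \<in> affine \<alpha> c S \<longleftrightarrow> (x - \<alpha>) / c \<in> S"
  by (force simp: affine_def scaled_def image_iff)

lemma affine_V_iff:
  assumes "c \<noteq> 0"
  shows "x \<in> affine \<alpha> c V \<longleftrightarrow> v c \<le> v (x - \<alpha>)"
  using assms v_mult_cancel_le[of c 1 "(x - \<alpha>) / c"] by (simp add: affine_iff V_iff)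

lemma affine_max_ideal_iff:
  assumes "c \<noteq> 0"
  shows "x \<in> affine \<alpha> c (max_ideal V) \<longleftrightarrow> v c < v (x - \<alpha>)"
  using assms v_mult_cancel_less[of c 1 "(x - \<alpha>) / c"] by (simp add: affine_iff max_ideal_iff)

lemma scaled_max_ideal_iff: "c \<noteq> 0 \<Longrightarrow> x \<in> scaled c (max_ideal V) \<longleftrightarrow> v c < v x"
  using affine_max_ideal_iff[of c x 0] by (simp add: affine_def)

section \<open>Density of the value group\<close>

lemma nontrivial:
  assumes "\<not> finitely_generated_ideal V (max_ideal V)"
  shows "\<exists>e. e \<noteq> 0 \<and> v 1 < v e"
proof (rule ccontr)
  assume "\<not> ?thesis"
  \<comment> \<open>Without nonzero non-units the maximal ideal is zero, and the empty set generates
    it.\<close>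
  then have "max_ideal V = ideal_generated V {}"
    by (auto simp: max_ideal_iff ideal_generated_def)
  then show False
    using assms by (auto simp: finitely_generated_ideal_def)
qed

text \<open>If no value lay strictly between those of \<open>1\<close> and \<open>d\<close>, then
  \<open>d\<close> would divide every non-unit and generate the maximal ideal.\<close>

lemma dense:
  assumes fg: "\<not> finitely_generated_ideal V (max_ideal V)" and d: "v 1 < v d"
  shows "\<exists>e. v 1 < v e \<and> v e < v d"
proof (rule ccontr)
  assume no: "\<not> ?thesis"
  \<comment> \<open>For \<open>d = 0\<close>, any nonzero non-unit would already have a value
    strictly in between.\<close>
  have d0: "d \<noteq> 0"
    using no nontrivial[OF fg] by auto
  have "max_ideal V = ideal_generated V {d}"
  proof (intro equalityI subsetI)
    fix x assume "x \<in> max_ideal V"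
    then have "v d \<le> v x"
      using no by (auto simp: max_ideal_iff)
    then have "x / d \<in> V"
      using d0 v_mult_cancel_le[of d 1 "x / d"] by (simp add: V_iff)
    moreover have "x = (\<Sum>s\<in>{d}. x / d * s)"
      using d0 by simp
    ultimately show "x \<in> ideal_generated V {d}"
      unfolding ideal_generated_def
      by (intro CollectI exI[of _ "{d}"] exI[of _ "\<lambda>_. x / d"]) simp
  next
    fix x assume "x \<in> ideal_generated V {d}"
    then obtain T a where T: "T \<subseteq> {d}" "a ` T \<subseteq> V" and x: "x = (\<Sum>s\<in>T. a s * s)"
      unfolding ideal_generated_def by blast
    have "v 1 < v (a s * s)" if "s \<in> T" for s
      using that T d v_mult_mono[of 1 "a s" d d] by (force simp: V_iff)
    then show "x \<in> max_ideal V"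
      unfolding max_ideal_iff x by (rule v_sum_gt) auto
  qed
  moreover have "d \<in> V"
    using d by (simp add: V_iff)
  ultimately show False
    using fg by (auto simp: finitely_generated_ideal_def)
qed

text \<open>Approximate division by \<open>n\<close> in a value group that need not be divisible. In
  the induction the slack \<open>d / e ^ n\<close> has positive value, so density leaves room for
  one more factor.\<close>

lemma small_power:
  assumes fg: "\<not> finitely_generated_ideal V (max_ideal V)" and d: "v 1 < v d"
  shows "\<exists>e. e \<noteq> 0 \<and> v 1 < v e \<and> v (e ^ n) < v d"
proof (induction n)
  case 0
  then show ?case using d nontrivial[OF fg] by simp
next
  case (Suc n)
  then obtain e where e: "e \<noteq> 0" "v 1 < v e" "v (e ^ n) < v d" by blast
  then have "v 1 < v (d / e ^ n)"
    using v_mult_cancel_less[of "e ^ n" 1 "d / e ^ n"] by simp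
  then obtain f where f: "v 1 < v f" "v f < v (d / e ^ n)"
    using dense[OF fg] by blast
  then have f0: "f \<noteq> 0" by auto
  \<comment> \<open>\<open>g\<close> is whichever of \<open>e\<close> and \<open>f\<close> has the
    smaller value: \<open>n\<close> factors cost at most \<open>e ^ n\<close>, the remaining one at
    most \<open>f\<close>.\<close>
  obtain g where g: "g \<noteq> 0" "v 1 < v g" "v g \<le> v e" "v g \<le> v f"
    using e f f0 by (metis linorder_linear order_refl)
  have "v (g * g ^ n) \<le> v (f * e ^ n)"
    by (intro v_mult_mono v_power_mono g)
  also have "\<dots> < v (d / e ^ n * e ^ n)"
    using f e by (intro v_mult_strict) auto
  finally show ?case using e g by auto
qed

section \<open>Values of polynomials\<close>

text \<open>The reverse inequality \<open>min\<^sub>i v (a\<^sub>i x\<^sup>i) \<le> v (p x)\<close> always holds, so for regular \<open>x\<close> the value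
  \<open>v (p x)\<close> is that of the least monomial.\<close>

definition regular :: "'k poly \<Rightarrow> 'k \<Rightarrow> bool" where
  "regular p x \<longleftrightarrow> (\<forall>i. v (poly p x) \<le> v (coeff p i * x ^ i))"

text \<open>A comparison of the two minima of monomial values, written with bounded quantifiers so
  that finitely many comparisons of monomials decide it.\<close>

definition dominates :: "'k poly \<Rightarrow> 'k poly \<Rightarrow> 'k \<Rightarrow> bool" where
  "dominates p q x \<longleftrightarrow>
     (\<forall>i\<in>{..degree p}. \<exists>j\<in>{..degree q}. v (coeff q j * x ^ j) \<le> v (coeff p i * x ^ i))"

lemma v_poly_ge: "(\<And>i. i \<le> degree p \<Longrightarrow> t \<le> v (coeff p i * x ^ i)) \<Longrightarrow> t \<le> Pinf \<Longrightarrow> t \<le> v (poly p x)"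
  unfolding poly_altdef by (rule v_sum_ge) auto

lemma min_monomial: "\<exists>k\<le>degree p. \<forall>i. v (coeff p k * x ^ k) \<le> v (coeff p i * x ^ i)"
proof -
  define k where "k = arg_min_on (\<lambda>i. v (coeff p i * x ^ i)) {..degree p}"
  have k: "k \<in> {..degree p}" "\<not> (\<exists>i\<in>{..degree p}. v (coeff p i * x ^ i) < v (coeff p k * x ^ k))"
    unfolding k_def by (rule arg_min_if_finite; simp)+
  have "v (coeff p k * x ^ k) \<le> v (coeff p i * x ^ i)" for i
    using k(2) by (cases "i \<le> degree p") (force simp: coeff_eq_0)+
  with k(1) show ?thesis by auto
qed

lemma min_monomial_nonzero:
  assumes "\<And>i. v (coeff p k * x ^ k) \<le> v (coeff p i * x ^ i)" "p \<noteq> 0" "x \<noteq> 0"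
  shows "coeff p k * x ^ k \<noteq> 0"
proof
  assume "coeff p k * x ^ k = 0"
  then have "coeff p (degree p) * x ^ degree p = 0"
    using assms(1)[of "degree p"] by (metis Pinf_le_v v_zero)
  with assms(2,3) show False by simp
qed

text \<open>At a regular point the value of each polynomial is that of its least monomial.\<close>

lemma dominates_iff:
  assumes "regular p x" "regular q x"
  shows "v (poly q x) \<le> v (poly p x) \<longleftrightarrow> dominates p q x"
proof
  assume le: "v (poly q x) \<le> v (poly p x)"
  obtain k where k: "k \<le> degree q" "\<forall>i. v (coeff q k * x ^ k) \<le> v (coeff q i * x ^ i)"
    using min_monomial by blast
  then have "v (coeff q k * x ^ k) \<le> v (poly q x)"
    by (intro v_poly_ge) auto
  with le assms(1) have "v (coeff q k * x ^ k) \<le> v (coeff p i * x ^ i)" for i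
    unfolding regular_def by (meson order_trans)
  with k show "dominates p q x"
    by (auto simp: dominates_def)
next
  assume "dominates p q x"
  then show "v (poly q x) \<le> v (poly p x)"
    using assms(2) unfolding regular_def dominates_def
    by (intro v_poly_ge) (auto intro: order_trans)
qed

text \<open>A root would have infinite value, and regularity would force the leading monomial to
  vanish.\<close>

lemma regular_poly_nonzero:
  assumes "regular p x" "p \<noteq> 0" "x \<noteq> 0"
  shows "poly p x \<noteq> 0"
proof
  assume "poly p x = 0"
  with assms have "coeff p (degree p) * x ^ degree p = 0"
    unfolding regular_def by (metis Pinf_le_v v_zero)
  with assms show False by simp
qed

lemma dominates_cong:
  assumes "v x = v y"
  shows "dominates p q x \<longleftrightarrow> dominates p q y"
  by (simp add: dominates_def v_mult v_power_eq[OF assms])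

text \<open>Without ties the least monomial is unique; the others sum to an element of strictly
  larger value, so nothing cancels.\<close>

lemma regular_if_distinct:
  assumes "x \<noteq> 0"
    and distinct: "\<And>i j. i < j \<Longrightarrow> j \<le> degree p \<Longrightarrow> coeff p i \<noteq> 0 \<Longrightarrow> coeff p j \<noteq> 0
      \<Longrightarrow> v (coeff p i * x ^ i) \<noteq> v (coeff p j * x ^ j)"
  shows "regular p x"
proof (cases "p = 0")
  case True
  then show ?thesis by (simp add: regular_def)
next
  case False
  obtain k where k: "k \<le> degree p" "\<And>i. v (coeff p k * x ^ k) \<le> v (coeff p i * x ^ i)"
    using min_monomial by blast
  have k0: "coeff p k \<noteq> 0"
    using min_monomial_nonzero[OF k(2) False assms(1)] by auto
  have "v (coeff p k * x ^ k) < v (coeff p i * x ^ i)" if "i \<in> {..degree p} - {k}" for i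
  proof (cases "coeff p i = 0")
    case True
    then show ?thesis using k0 assms(1) by simp
  next
    case False
    then show ?thesis
      using that k k0 distinct[of i k] distinct[of k i]
      by (metis DiffE atMost_iff insertI1 linorder_neqE_nat order_le_less)
  qed
  then have "v (coeff p k * x ^ k) < v (\<Sum>i\<in>{..degree p} - {k}. coeff p i * x ^ i)"
    using k0 assms(1) by (intro v_sum_gt) auto
  moreover have "poly p x = coeff p k * x ^ k + (\<Sum>i\<in>{..degree p} - {k}. coeff p i * x ^ i)"
    unfolding poly_altdef using k(1) by (simp add: sum.remove)
  ultimately have "v (poly p x) = v (coeff p k * x ^ k)"
    by (simp add: v_add_eq)
  with k show ?thesis by (simp add: regular_def)
qed

text \<open>The coefficients of \<open>p\<close> and \<open>q\<close> are the Taylor coefficients of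
  \<open>P\<close> and \<open>Q\<close> at \<beta>. Regularity keeps the denominator from vanishing
  and turns membership of the quotient in \<open>V\<close> into a comparison of minima.\<close>

lemma in_seq_ring_iff:
  assumes idx: "index_set \<Lambda>" and Q: "Q \<noteq> 0"
    and p: "p = pcompose P [:\<beta>, 1:]" and q: "q = pcompose Q [:\<beta>, 1:]"
    and reg: "\<forall>\<^sub>F x in increments \<Lambda> s \<beta>. x \<noteq> 0 \<and> regular p x \<and> regular q x"
  shows "Fract P Q \<in> seq_ring V \<Lambda> s \<longleftrightarrow> (\<forall>\<^sub>F x in increments \<Lambda> s \<beta>. dominates p q x)"
proof -
  have q0: "q \<noteq> 0"
    using Q pcompose_eq_0[of Q "[:\<beta>, 1:]"] by (auto simp: q)
  have key: "(\<exists>y\<in>V. rat_value (Fract P Q) (\<beta> + x) y) \<longleftrightarrow> dominates p q x"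
    if x: "x \<noteq> 0" "regular p x" "regular q x" for x
  proof -
    have ev: "poly p x = poly P (\<beta> + x)" "poly q x = poly Q (\<beta> + x)"
      by (simp_all add: p q poly_pcompose)
    have nz: "poly q x \<noteq> 0"
      using regular_poly_nonzero x q0 by blast
    then have "rat_value (Fract P Q) (\<beta> + x) (poly p x / poly q x)"
      unfolding rat_value_def ev by blast
    then have "(\<exists>y\<in>V. rat_value (Fract P Q) (\<beta> + x) y) \<longleftrightarrow> poly p x / poly q x \<in> V"
      using rat_value_unique by blast
    also have "\<dots> \<longleftrightarrow> v (poly q x) \<le> v (poly p x)"
      using nz v_mult_cancel_le[of "poly q x" 1 "poly p x / poly q x"] by (simp add: V_iff)
    finally show ?thesis
      using dominates_iff x by blast
  qed
  have "Fract P Q \<in> seq_ring V \<Lambda> s \<longleftrightarrow>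
      (\<forall>\<^sub>F x in increments \<Lambda> s \<beta>. \<exists>y\<in>V. rat_value (Fract P Q) (\<beta> + x) y)"
    by (simp add: seq_ring_def eventually_increments idx)
  also have "\<dots> \<longleftrightarrow> (\<forall>\<^sub>F x in increments \<Lambda> s \<beta>. dominates p q x)"
    by (rule eventually_cong[OF reg]) (use key in blast)
  finally show ?thesis .
qed

text \<open>\<open>near c G\<close>: along \<open>G\<close>, \<open>v x\<close> tends to \<open>v c\<close> without attaining it.\<close>

definition near :: "'k \<Rightarrow> 'k filter \<Rightarrow> bool" where
  "near c G \<longleftrightarrow> (\<forall>\<^sub>F x in G. v x \<noteq> v c) \<and>
     (\<forall>e. e \<noteq> 0 \<longrightarrow> v 1 < v e \<longrightarrow> (\<forall>\<^sub>F x in G. v c < v (e * x) \<and> v x < v (e * c)))"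

lemma near_nonzero:
  assumes "\<not> finitely_generated_ideal V (max_ideal V)" "near c G"
  shows "\<forall>\<^sub>F x in G. x \<noteq> 0"
proof -
  obtain e where "e \<noteq> 0" "v 1 < v e"
    using nontrivial assms(1) by blast
  then have "\<forall>\<^sub>F x in G. v x < v (e * c)"
    using assms(2) by (auto simp: near_def elim: eventually_mono)
  then show ?thesis
    by (rule eventually_mono) auto
qed

text \<open>If \<open>v t\<close> differs from \<open>v c\<close>, then \<open>t / c\<close> or
  \<open>c / t\<close> has positive value and serves as the \<open>e\<close> in \<open>near\<close>
  that separates them.\<close>

lemma near_avoids:
  assumes "near c G" "c \<noteq> 0" "t \<noteq> 0"
  shows "\<forall>\<^sub>F x in G. v x \<noteq> v t"
proof -
  consider "v t = v c" | "v c < v t" | "v t < v c" by fastforce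
  then show ?thesis
  proof cases
    case 1
    then show ?thesis using assms(1) by (simp add: near_def)
  next
    case 2
    then have "v 1 < v (t / c)"
      using assms v_mult_cancel_less[of c 1 "t / c"] by simp
    moreover have "t / c \<noteq> 0"
      using assms by simp
    ultimately have "\<forall>\<^sub>F x in G. v c < v (t / c * x) \<and> v x < v (t / c * c)"
      using assms(1) unfolding near_def by blast
    then show ?thesis
      by (rule eventually_mono) (use assms in auto)
  next
    case 3
    then have "v 1 < v (c / t)"
      using assms v_mult_cancel_less[of t 1 "c / t"] by simp
    moreover have "c / t \<noteq> 0"
      using assms by simp
    ultimately have "\<forall>\<^sub>F x in G. v c < v (c / t * x) \<and> v x < v (c / t * c)"
      using assms(1) unfolding near_def by blast
    then show ?thesis
    proof (rule eventually_mono)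
      fix x assume "v c < v (c / t * x) \<and> v x < v (c / t * c)"
      then have "v t < v x"
        using assms v_mult_cancel_less[of "c / t" t x] by simp
      then show "v x \<noteq> v t" by simp
    qed
  qed
qed

text \<open>Two monomials can have equal values only on a single sphere, as the value group is torsion-free.\<close>

lemma near_regular:
  assumes fg: "\<not> finitely_generated_ideal V (max_ideal V)" and near: "near c G" and c: "c \<noteq> 0"
  shows "\<forall>\<^sub>F x in G. regular p x"
proof -
  have pair: "\<forall>\<^sub>F x in G. i < j \<longrightarrow> coeff p i \<noteq> 0 \<longrightarrow> coeff p j \<noteq> 0 \<longrightarrow>
      v (coeff p i * x ^ i) \<noteq> v (coeff p j * x ^ j)" for i j
  proof (cases "\<exists>t. t \<noteq> 0 \<and> i < j \<and> coeff p i \<noteq> 0 \<and> coeff p j \<noteq> 0 \<and>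
      v (coeff p i * t ^ i) = v (coeff p j * t ^ j)")
    case False
    show ?thesis
      using near_nonzero[OF fg near] by (rule eventually_mono) (use False in blast)
  next
    case True
    \<comment> \<open>A tie at \<open>t\<close> fixes the only sphere on which a tie can occur, and
      \<open>G\<close> eventually leaves it.\<close>
    then obtain t where t: "t \<noteq> 0" "i < j" "coeff p i \<noteq> 0" "coeff p j \<noteq> 0"
      "v (coeff p i * t ^ i) = v (coeff p j * t ^ j)" by blast
    \<comment> \<open>Cancelling \<open>x ^ i\<close> leaves a condition on the value of
      \<open>x ^ (j - i)\<close> alone, which is compared at \<open>x\<close> and at
      \<open>t\<close>.\<close>
    have reduce: "v (coeff p i * x ^ i) = v (coeff p j * x ^ j) \<longleftrightarrow>
        v (coeff p i) = v (coeff p j * x ^ (j - i))" if "x \<noteq> 0" for x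
    proof -
      have "coeff p j * x ^ j = x ^ i * (coeff p j * x ^ (j - i))"
        using t(2) by (simp flip: power_add)
      then show ?thesis
        using that v_mult_cancel_eq[of "x ^ i" "coeff p i" "coeff p j * x ^ (j - i)"]
        by (metis mult.commute power_not_zero)
    qed
    show ?thesis
      using near_avoids[OF near c t(1)] near_nonzero[OF fg near]
    proof eventually_elim
      case (elim x)
      show ?case
      proof (intro impI notI)
        assume "v (coeff p i * x ^ i) = v (coeff p j * x ^ j)"
        then have "v (coeff p j * x ^ (j - i)) = v (coeff p j * t ^ (j - i))"
          using reduce[of x] reduce[of t] elim t by simp
        then have "v x = v t"
          using t elim v_power_inject[of x "j - i" t] by simp
        with elim show False by simp
      qed
    qed
  qed
  have "\<forall>\<^sub>F x in G. \<forall>i\<in>{..degree p}. \<forall>j\<in>{..degree p}. i < j \<longrightarrow> coeff p i \<noteq> 0 \<longrightarrow> coeff p j \<noteq> 0 \<longrightarrow>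
      v (coeff p i * x ^ i) \<noteq> v (coeff p j * x ^ j)"
    using pair by (auto intro!: eventually_ball_finite)
  with near_nonzero[OF fg near] show ?thesis
    by eventually_elim (rule regular_if_distinct, auto)
qed

text \<open>The inequality at \<open>c\<close> has a positive gap \<open>v d\<close>. Writing
  \<open>x = c * y\<close>, the passage from \<open>c\<close> to \<open>x\<close> changes the gap by
  at most \<open>i + j\<close> times \<open>v e\<close>, and \<open>e\<close> is chosen so that this
  is less than \<open>v d\<close>.\<close>

lemma near_monomials:
  assumes fg: "\<not> finitely_generated_ideal V (max_ideal V)" and near: "near c G" and c: "c \<noteq> 0"
    and less: "v (a * c ^ i) < v (b * c ^ j)"
  shows "\<forall>\<^sub>F x in G. v (a * x ^ i) < v (b * x ^ j)"
proof (cases "b = 0")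
  case True
  with less c have "a \<noteq> 0" by auto
  with True show ?thesis
    by (intro eventually_mono[OF near_nonzero[OF fg near]]) simp
next
  case False
  have a: "a \<noteq> 0" using less by auto
  define d where "d = (b * c ^ j) / (a * c ^ i)"
  have bc: "b * c ^ j = a * c ^ i * d"
    using a c by (simp add: d_def)
  with less have "v 1 < v d"
    using a c v_mult_cancel_less[of "a * c ^ i" 1 d] by simp
  then obtain e where e: "e \<noteq> 0" "v 1 < v e" "v (e ^ (i + j)) < v d"
    using small_power[OF fg] by blast
  have "\<forall>\<^sub>F x in G. v c < v (e * x) \<and> v x < v (e * c)"
    using near e by (auto simp: near_def)
  with near_nonzero[OF fg near] show ?thesis
  proof eventually_elim
    case (elim x)
    define y where "y = x / c"
    have x: "x = c * y" and y: "y \<noteq> 0"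
      using c elim by (auto simp: y_def)
    have y1: "v y \<le> v e"
      using elim c by (simp add: x mult.commute[of e] less_imp_le)
    \<comment> \<open>The other half of \<open>near\<close>, \<open>v c < v (e * x)\<close>, bounds
      the value of \<open>1 / y\<close> by that of \<open>e\<close>.\<close>
    have "v 1 < v (e * y)"
      using elim c v_mult_cancel_less[of c 1 "e * y"] by (simp add: x mult.left_commute)
    then have "v (y * (1 / y)) < v (y * e)"
      using y by (simp add: mult.commute)
    then have y2: "v (1 / y) \<le> v e"
      using y v_mult_cancel_less[of y "1 / y" e] by simp
    have "v (y ^ i * (1 / y) ^ j) \<le> v (e ^ (i + j))"
      unfolding power_add by (intro v_mult_mono v_power_mono y1 y2)
    also have "\<dots> < v d" by (rule e(3))
    finally have "v (y ^ j * (y ^ i * (1 / y) ^ j)) < v (y ^ j * d)"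
      using y by simp
    also have "y ^ j * (y ^ i * (1 / y) ^ j) = y ^ i"
      using y by (simp add: power_one_over field_simps)
    finally have "v (a * c ^ i * y ^ i) < v (a * c ^ i * (y ^ j * d))"
      using a c by simp
    also have "a * c ^ i * (y ^ j * d) = b * x ^ j"
      using bc by (simp add: x power_mult_distrib ac_simps)
    also have "a * c ^ i * y ^ i = a * x ^ i"
      by (simp add: x power_mult_distrib)
    finally show ?case .
  qed
qed

text \<open>Failure at \<open>c\<close> means that one monomial of \<open>p\<close> lies strictly
  below all monomials of \<open>q\<close>. Finitely many strict inequalities persist along
  \<open>G\<close>, which contradicts domination there.\<close>

lemma near_dominates:
  assumes fg: "\<not> finitely_generated_ideal V (max_ideal V)" and near: "near c G" and c: "c \<noteq> 0"
    and G: "G \<noteq> bot" and dom: "\<forall>\<^sub>F x in G. dominates p q x"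
  shows "dominates p q c"
proof (rule ccontr)
  assume "\<not> ?thesis"
  then obtain i where i: "i \<in> {..degree p}"
    "\<forall>j\<in>{..degree q}. v (coeff p i * c ^ i) < v (coeff q j * c ^ j)"
    by (auto simp: dominates_def not_le)
  then have "\<forall>\<^sub>F x in G. \<forall>j\<in>{..degree q}. v (coeff p i * x ^ i) < v (coeff q j * x ^ j)"
    using near_monomials[OF fg near c] by (auto intro!: eventually_ball_finite)
  with dom have "\<forall>\<^sub>F x in G. False"
    by eventually_elim (use i(1) in \<open>simp add: dominates_def flip: not_le, blast\<close>)
  with G show False by simp
qed

section \<open>Approach from above\<close>

text \<open>The filter of values descending to \<open>v c\<close> without reaching it. It depends
  only on \<open>c\<close> and so is a common reference for all the pseudo-divergent
  sequences.\<close>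

definition annulus :: "'k \<Rightarrow> 'k filter" where
  "annulus c = (INF e\<in>{e. e \<noteq> 0 \<and> v 1 < v e}. principal {x. v c < v x \<and> v x < v (e * c)})"

lemma eventually_annulus:
  assumes fg: "\<not> finitely_generated_ideal V (max_ideal V)"
  shows "eventually P (annulus c) \<longleftrightarrow>
    (\<exists>e. e \<noteq> 0 \<and> v 1 < v e \<and> (\<forall>x. v c < v x \<longrightarrow> v x < v (e * c) \<longrightarrow> P x))"
proof -
  let ?A = "\<lambda>e. principal {x. v c < v x \<and> v x < v (e * c)}"
  have "eventually P (annulus c) \<longleftrightarrow> (\<exists>e\<in>{e. e \<noteq> 0 \<and> v 1 < v e}. eventually P (?A e))"
    unfolding annulus_def
  proof (rule eventually_INF_base)
    show "{e. e \<noteq> 0 \<and> v 1 < v e} \<noteq> {}"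
      using nontrivial[OF fg] by blast
  next
    fix a b assume ab: "a \<in> {e. e \<noteq> 0 \<and> v 1 < v e}" "b \<in> {e. e \<noteq> 0 \<and> v 1 < v e}"
    obtain e where e: "e \<in> {e. e \<noteq> 0 \<and> v 1 < v e}" "v e \<le> v a" "v e \<le> v b"
    proof (cases "v a \<le> v b")
      case True
      with ab(1) show ?thesis by (intro that[of a]) auto
    next
      case False
      with ab(2) show ?thesis by (intro that[of b]) auto
    qed
    then have "v (e * c) \<le> v (a * c)" "v (e * c) \<le> v (b * c)"
      by (auto intro: v_mult_mono)
    with e(1) show "\<exists>x\<in>{e. e \<noteq> 0 \<and> v 1 < v e}. ?A x \<le> inf (?A a) (?A b)"
      by (intro bexI[of _ e]) (auto intro: less_le_trans)
  qed
  then show ?thesis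
    by (auto simp: eventually_principal)
qed

lemma le_annulusI:
  assumes "\<And>e. e \<noteq> 0 \<Longrightarrow> v 1 < v e \<Longrightarrow> \<forall>\<^sub>F x in G. v c < v x \<and> v x < v (e * c)"
  shows "G \<le> annulus c"
  unfolding annulus_def using assms by (auto simp: le_INF_iff le_principal)

lemma near_annulus:
  assumes fg: "\<not> finitely_generated_ideal V (max_ideal V)" and G: "G \<le> annulus c"
  shows "near c G"
proof -
  have ev: "\<forall>\<^sub>F x in G. v c < v x \<and> v x < v (e * c)" if "e \<noteq> 0" "v 1 < v e" for e
    using that by (intro filter_leD[OF G]) (auto simp: eventually_annulus[OF fg])
  obtain e where "e \<noteq> 0" "v 1 < v e"
    using nontrivial[OF fg] by blast
  from ev[OF this] have "\<forall>\<^sub>F x in G. v x \<noteq> v c"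
    by (rule eventually_mono) auto
  moreover have "\<forall>\<^sub>F x in G. v c < v (e * x) \<and> v x < v (e * c)" if e: "e \<noteq> 0" "v 1 < v e" for e
    using ev[OF e]
  proof (rule eventually_mono)
    fix x assume x: "v c < v x \<and> v x < v (e * c)"
    have "v (1 * x) \<le> v (e * x)"
      by (rule v_mult_mono) (use e in auto)
    with x show "v c < v (e * x) \<and> v x < v (e * c)" by auto
  qed
  ultimately show ?thesis by (simp add: near_def)
qed

text \<open>Either \<open>P\<close> holds throughout an annulus, or it fails at some nonzero
  \<open>t\<close> with \<open>v c < v t\<close>; then monotonicity makes it fail wherever the value
  is below \<open>v t\<close>, which is a neighbourhood given by \<open>e = t / c\<close>.\<close>

lemma annulus_decides_monotone:
  assumes fg: "\<not> finitely_generated_ideal V (max_ideal V)" and c: "c \<noteq> 0"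
    and mono: "\<And>x y. v x \<le> v y \<Longrightarrow> P x \<Longrightarrow> P y"
  shows "eventually P (annulus c) \<or> (\<forall>\<^sub>F x in annulus c. \<not> P x)"
proof (cases "\<exists>t. t \<noteq> 0 \<and> v c < v t \<and> \<not> P t")
  case True
  then obtain t where t: "t \<noteq> 0" "v c < v t" "\<not> P t" by blast
  then have "v 1 < v (t / c)"
    using c v_mult_cancel_less[of c 1 "t / c"] by simp
  moreover have "\<not> P x" if "v x < v (t / c * c)" for x
    using that t c mono[of x t] by (auto simp: less_imp_le)
  ultimately have "\<forall>\<^sub>F x in annulus c. \<not> P x"
    using t c by (auto simp: eventually_annulus[OF fg] intro!: exI[of _ "t / c"])
  then show ?thesis ..
next
  case False
  obtain e where "e \<noteq> 0" "v 1 < v e"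
    using nontrivial[OF fg] by blast
  moreover have "P x" if "v c < v x" "v x < v (e * c)" for x
    using that False by (metis v_eq_Pinf v_less_Pinf v_le_Pinf not_le)
  ultimately show ?thesis
    by (auto simp: eventually_annulus[OF fg])
qed

text \<open>Dividing by the smaller power of \<open>x\<close> leaves a power on one side only. The
  comparison is then upward closed in \<open>v x\<close> if \<open>i \<le> j\<close>, and otherwise
  its negation is.\<close>

lemma annulus_decides_monomials:
  assumes fg: "\<not> finitely_generated_ideal V (max_ideal V)" and c: "c \<noteq> 0"
  shows "(\<forall>\<^sub>F x in annulus c. v (a * x ^ i) \<le> v (b * x ^ j)) \<or>
    (\<forall>\<^sub>F x in annulus c. \<not> v (a * x ^ i) \<le> v (b * x ^ j))"
proof -
  note nonzero = near_nonzero[OF fg near_annulus[OF fg order_refl], of c]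
  show ?thesis
  proof (cases "i \<le> j")
    case True
    have eq: "v (a * x ^ i) \<le> v (b * x ^ j) \<longleftrightarrow> v a \<le> v (b * x ^ (j - i))" if "x \<noteq> 0" for x
    proof -
      have "b * x ^ j = x ^ i * (b * x ^ (j - i))"
        using True by (simp flip: power_add)
      then show ?thesis
        using that v_mult_cancel_le[of "x ^ i" a "b * x ^ (j - i)"]
        by (metis mult.commute power_not_zero)
    qed
    have "(\<forall>\<^sub>F x in annulus c. v a \<le> v (b * x ^ (j - i))) \<or>
        (\<forall>\<^sub>F x in annulus c. \<not> v a \<le> v (b * x ^ (j - i)))"
    proof (rule annulus_decides_monotone[OF fg c])
      fix x y assume "v x \<le> v y" "v a \<le> v (b * x ^ (j - i))"
      moreover from this(1) have "v (b * x ^ (j - i)) \<le> v (b * y ^ (j - i))"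
        by (intro v_mult_mono v_power_mono) auto
      ultimately show "v a \<le> v (b * y ^ (j - i))" by simp
    qed
    moreover have "(\<forall>\<^sub>F x in annulus c. v (a * x ^ i) \<le> v (b * x ^ j)) \<longleftrightarrow>
        (\<forall>\<^sub>F x in annulus c. v a \<le> v (b * x ^ (j - i)))"
      by (rule eventually_cong[OF nonzero]) (use eq in blast)
    moreover have "(\<forall>\<^sub>F x in annulus c. \<not> v (a * x ^ i) \<le> v (b * x ^ j)) \<longleftrightarrow>
        (\<forall>\<^sub>F x in annulus c. \<not> v a \<le> v (b * x ^ (j - i)))"
      by (rule eventually_cong[OF nonzero]) (use eq in blast)
    ultimately show ?thesis by blast
  next
    case False
    have eq: "v (a * x ^ i) \<le> v (b * x ^ j) \<longleftrightarrow> \<not> v b < v (a * x ^ (i - j))" if "x \<noteq> 0" for x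
    proof -
      have "a * x ^ i = x ^ j * (a * x ^ (i - j))"
        using False by (simp flip: power_add)
      then show ?thesis
        using that v_mult_cancel_le[of "x ^ j" "a * x ^ (i - j)" b]
        by (metis mult.commute power_not_zero not_less)
    qed
    have "(\<forall>\<^sub>F x in annulus c. v b < v (a * x ^ (i - j))) \<or>
        (\<forall>\<^sub>F x in annulus c. \<not> v b < v (a * x ^ (i - j)))"
    proof (rule annulus_decides_monotone[OF fg c])
      fix x y assume "v x \<le> v y" "v b < v (a * x ^ (i - j))"
      moreover from this(1) have "v (a * x ^ (i - j)) \<le> v (a * y ^ (i - j))"
        by (intro v_mult_mono v_power_mono) auto
      ultimately show "v b < v (a * y ^ (i - j))" by simp
    qed
    moreover have "(\<forall>\<^sub>F x in annulus c. v (a * x ^ i) \<le> v (b * x ^ j)) \<longleftrightarrow>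
        (\<forall>\<^sub>F x in annulus c. \<not> v b < v (a * x ^ (i - j)))"
      by (rule eventually_cong[OF nonzero]) (use eq in blast)
    moreover have "(\<forall>\<^sub>F x in annulus c. \<not> v (a * x ^ i) \<le> v (b * x ^ j)) \<longleftrightarrow>
        (\<forall>\<^sub>F x in annulus c. v b < v (a * x ^ (i - j)))"
      by (rule eventually_cong[OF nonzero]) (use eq in blast)
    ultimately show ?thesis by blast
  qed
qed

lemma annulus_decides_dominates:
  assumes "\<not> finitely_generated_ideal V (max_ideal V)" and "c \<noteq> 0"
  shows "eventually (dominates p q) (annulus c) \<or> (\<forall>\<^sub>F x in annulus c. \<not> dominates p q x)"
  unfolding dominates_def
  by (intro eventually_decided_ball eventually_decided_bex annulus_decides_monomials assms) auto

section \<open>Comparison of the rings of two sequences\<close>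

lemma seq_ring_annulus_iff:
  assumes fg: "\<not> finitely_generated_ideal V (max_ideal V)" and c: "c \<noteq> 0"
    and idx: "index_set \<Lambda>" and incr: "increments \<Lambda> s \<beta> \<le> annulus c" and Q: "Q \<noteq> 0"
  shows "Fract P Q \<in> seq_ring V \<Lambda> s \<longleftrightarrow>
    eventually (dominates (pcompose P [:\<beta>, 1:]) (pcompose Q [:\<beta>, 1:])) (annulus c)"
    (is "_ \<longleftrightarrow> eventually ?dom _")
proof -
  note near = near_annulus[OF fg incr]
  have "\<forall>\<^sub>F x in increments \<Lambda> s \<beta>. x \<noteq> 0 \<and> regular (pcompose P [:\<beta>, 1:]) x \<and> regular (pcompose Q [:\<beta>, 1:]) x"
    by (intro eventually_conj near_nonzero[OF fg near] near_regular[OF fg near c])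
  then have "Fract P Q \<in> seq_ring V \<Lambda> s \<longleftrightarrow> eventually ?dom (increments \<Lambda> s \<beta>)"
    by (intro in_seq_ring_iff[OF idx Q refl refl])
  also have "\<dots> \<longleftrightarrow> eventually ?dom (annulus c)"
  proof
    assume "eventually ?dom (increments \<Lambda> s \<beta>)"
    \<comment> \<open>The increments form a finer filter that is not \<open>bot\<close>, so the
      negative alternative along the annulus is impossible.\<close>
    then have "\<not> (\<forall>\<^sub>F x in annulus c. \<not> ?dom x)"
      using filter_leD[OF incr] increments_not_eventually[OF idx] by blast
    with annulus_decides_dominates[OF fg c] show "eventually ?dom (annulus c)" by blast
  qed (rule filter_leD[OF incr])
  finally show ?thesis .
qed

text \<open>Both memberships reduce to one condition on \<open>P\<close>, \<open>Q\<close>, \<beta>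
  and \<open>c\<close>, in which the sequences no longer occur.\<close>

lemma seq_ring_annulus_eq:
  assumes fg: "\<not> finitely_generated_ideal V (max_ideal V)" and c: "c \<noteq> 0"
    and "index_set \<Lambda>" "increments \<Lambda> s \<beta> \<le> annulus c"
    and "index_set \<Lambda>'" "increments \<Lambda>' s' \<beta> \<le> annulus c"
  shows "seq_ring V \<Lambda> s = seq_ring V \<Lambda>' s'"
proof (rule set_eqI)
  fix \<phi> :: "'k poly fract"
  obtain P Q where "\<phi> = Fract P Q" "Q \<noteq> 0" by (cases \<phi>)
  then show "\<phi> \<in> seq_ring V \<Lambda> s \<longleftrightarrow> \<phi> \<in> seq_ring V \<Lambda>' s'"
    using seq_ring_annulus_iff[OF fg c assms(3,4), of Q P] seq_ring_annulus_iff[OF fg c assms(5,6), of Q P]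
    by simp
qed

text \<open>Domination passes from nearby values to \<open>v c\<close> itself, and the second
  sequence eventually stays on the sphere of that value. This serves approach from below and from
  above alike.\<close>

lemma seq_ring_near_subset:
  assumes fg: "\<not> finitely_generated_ideal V (max_ideal V)" and c: "c \<noteq> 0"
    and idx: "index_set \<Lambda>" and near: "near c (increments \<Lambda> s \<beta>)"
    and idx': "index_set \<Lambda>'" and sphere: "\<forall>\<^sub>F x in increments \<Lambda>' s' \<beta>. v x = v c"
    and reg: "\<And>p. \<forall>\<^sub>F x in increments \<Lambda>' s' \<beta>. regular p x"
  shows "seq_ring V \<Lambda> s \<subseteq> seq_ring V \<Lambda>' s'"
proof
  fix \<phi> assume \<phi>: "\<phi> \<in> seq_ring V \<Lambda> s"
  obtain P Q where PQ: "\<phi> = Fract P Q" "Q \<noteq> 0" by (cases \<phi>)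
  let ?p = "pcompose P [:\<beta>, 1:]" and ?q = "pcompose Q [:\<beta>, 1:]"
  have "\<forall>\<^sub>F x in increments \<Lambda> s \<beta>. x \<noteq> 0 \<and> regular ?p x \<and> regular ?q x"
    by (intro eventually_conj near_nonzero[OF fg near] near_regular[OF fg near c])
  then have "eventually (dominates ?p ?q) (increments \<Lambda> s \<beta>)"
    using \<phi> PQ in_seq_ring_iff[OF idx PQ(2) refl refl] by blast
  then have dom: "dominates ?p ?q c"
    by (rule near_dominates[OF fg near c increments_neq_bot[OF idx]])
  have nonzero: "\<forall>\<^sub>F x in increments \<Lambda>' s' \<beta>. x \<noteq> 0"
    using sphere by (rule eventually_mono) (use c in \<open>metis v_eq_Pinf\<close>)
  have "\<forall>\<^sub>F x in increments \<Lambda>' s' \<beta>. x \<noteq> 0 \<and> regular ?p x \<and> regular ?q x"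
    by (intro eventually_conj nonzero reg)
  moreover have "eventually (dominates ?p ?q) (increments \<Lambda>' s' \<beta>)"
    using sphere by (rule eventually_mono) (use dom dominates_cong in blast)
  ultimately show "\<phi> \<in> seq_ring V \<Lambda>' s'"
    using PQ in_seq_ring_iff[OF idx' PQ(2) refl refl] by blast
qed

text \<open>The function \<open>(X - \<beta>) / c\<close> detects approach to \<open>v c\<close>
  from below.\<close>

lemma linear_in_seq_ring_iff:
  assumes idx: "index_set \<Lambda>" and c: "c \<noteq> 0"
  shows "Fract [:- \<beta>, 1:] [:c:] \<in> seq_ring V \<Lambda> s \<longleftrightarrow> (\<forall>\<^sub>F x in increments \<Lambda> s \<beta>. v c \<le> v x)"
proof -
  have "(\<exists>y\<in>V. rat_value (Fract [:- \<beta>, 1:] [:c:]) a y) \<longleftrightarrow> v c \<le> v (a - \<beta>)" for a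
  proof -
    have "rat_value (Fract [:- \<beta>, 1:] [:c:]) a ((a - \<beta>) / c)"
      unfolding rat_value_def using c
      by (intro exI[of _ "[:- \<beta>, 1:]"] exI[of _ "[:c:]"]) simp
    then have "(\<exists>y\<in>V. rat_value (Fract [:- \<beta>, 1:] [:c:]) a y) \<longleftrightarrow> (a - \<beta>) / c \<in> V"
      using rat_value_unique by blast
    then show ?thesis
      using c v_mult_cancel_le[of c 1 "(a - \<beta>) / c"] by (simp add: V_iff)
  qed
  then show ?thesis
    by (simp add: seq_ring_def eventually_increments idx)
qed

text \<open>The function \<open>c / (X - \<beta>)\<close> detects approach from above; nonzero
  increments avoid its pole.\<close>

lemma reciprocal_in_seq_ring_iff:
  assumes idx: "index_set \<Lambda>" and nonzero: "\<forall>\<^sub>F x in increments \<Lambda> s \<beta>. x \<noteq> 0"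
  shows "Fract [:c:] [:- \<beta>, 1:] \<in> seq_ring V \<Lambda> s \<longleftrightarrow> (\<forall>\<^sub>F x in increments \<Lambda> s \<beta>. v x \<le> v c)"
proof -
  have key: "(\<exists>y\<in>V. rat_value (Fract [:c:] [:- \<beta>, 1:]) (\<beta> + x) y) \<longleftrightarrow> v x \<le> v c" if "x \<noteq> 0" for x
  proof -
    have "rat_value (Fract [:c:] [:- \<beta>, 1:]) (\<beta> + x) (c / x)"
      unfolding rat_value_def using that
      by (intro exI[of _ "[:- \<beta>, 1:]"] exI[of _ "[:c:]"]) simp
    then have "(\<exists>y\<in>V. rat_value (Fract [:c:] [:- \<beta>, 1:]) (\<beta> + x) y) \<longleftrightarrow> c / x \<in> V"
      using rat_value_unique by blast
    then show ?thesis
      using that v_mult_cancel_le[of x 1 "c / x"] by (simp add: V_iff)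
  qed
  have "Fract [:c:] [:- \<beta>, 1:] \<in> seq_ring V \<Lambda> s \<longleftrightarrow>
      (\<forall>\<^sub>F x in increments \<Lambda> s \<beta>. \<exists>y\<in>V. rat_value (Fract [:c:] [:- \<beta>, 1:]) (\<beta> + x) y)"
    by (simp add: seq_ring_def eventually_increments idx)
  also have "\<dots> \<longleftrightarrow> (\<forall>\<^sub>F x in increments \<Lambda> s \<beta>. v x \<le> v c)"
    by (rule eventually_cong[OF nonzero]) (use key in blast)
  finally show ?thesis .
qed

section \<open>Residually distinct sequences\<close>

text \<open>Dividing by the root \<open>y\<close> modulo the maximal ideal leaves a polynomial that vanishes, modulo
  the maximal ideal, at the remaining roots and still has a unit coefficient.\<close>

lemma finite_residual_roots:
  assumes "\<And>y. y \<in> Y \<Longrightarrow> v 1 \<le> v y"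
    and "\<And>y y'. y \<in> Y \<Longrightarrow> y' \<in> Y \<Longrightarrow> y \<noteq> y' \<Longrightarrow> v (y - y') = v 1"
    and "\<And>i. v 1 \<le> v (coeff q i)" and "\<exists>i. v (coeff q i) = v 1"
  shows "finite {y \<in> Y. v 1 < v (poly q y)}"
  using assms(3,4)
proof (induction "degree q" arbitrary: q rule: less_induct)
  case less
  show ?case
  proof (cases "{y \<in> Y. v 1 < v (poly q y)} = {}")
    case False
    then obtain y where y: "y \<in> Y" "v 1 < v (poly q y)" by blast
    define r where "r = synthetic_div q y"
    have q: "q = [:- y, 1:] * r + [:poly q y:]"
      unfolding r_def by (rule synthetic_div_correct'[symmetric])
    have poly_q: "poly q x = (x - y) * poly r x + poly q y" for x
      by (subst q) (simp add: algebra_simps)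
    have r_V: "v 1 \<le> v (coeff r i)" for i
    proof -
      \<comment> \<open>The coefficients of \<open>synthetic_div u y\<close> are values at
        \<open>y\<close> of truncations of \<open>u\<close> from below, so they stay in
        \<open>V\<close>.\<close>
      have poly_V: "v 1 \<le> v (poly u y)" if "\<And>i. v 1 \<le> v (coeff u i)" for u
        using that
      proof (induction u)
        case (pCons a u)
        have "v 1 \<le> v (coeff u i)" for i
          using pCons.prems[of "Suc i"] by simp
        then have "v (1 * 1) \<le> v (y * poly u y)"
          using assms(1)[OF y(1)] pCons.IH by (intro v_mult_mono) auto
        then show ?case
          using pCons.prems[of 0] by (auto intro: v_add_ge)
      qed simp
      have "v 1 \<le> v (coeff (synthetic_div u y) i)" if "\<And>i. v 1 \<le> v (coeff u i)" for u i
        using that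
      proof (induction u arbitrary: i)
        case (pCons a u)
        have u: "v 1 \<le> v (coeff u i)" for i
          using pCons.prems[of "Suc i"] by simp
        then show ?case
          using pCons.IH poly_V[OF u] by (cases i) auto
      qed simp
      with less.prems(1) show ?thesis by (simp add: r_def)
    qed
    have r_unit: "\<exists>i. v (coeff r i) = v 1"
    proof (rule ccontr)
      assume "\<not> ?thesis"
      with r_V have r_M: "v 1 < v (coeff r i)" for i
        by (metis order_le_less)
      \<comment> \<open>If \<open>r\<close> vanished modulo the maximal ideal, so would
        \<open>(X - y) * r + q(y)\<close>, which is \<open>q\<close>.\<close>
      have "v 1 < v (coeff q i)" for i
      proof -
        have "v (1 * 1) < v (coeff r j * y)" for j
          using assms(1)[OF y(1)] by (intro v_mult_strict r_M) auto
        moreover have "v 1 < v (coeff (pCons 0 r) i)" "v 1 < v (coeff [:poly q y:] i)"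
          using r_M y(2) by (cases i; simp)+
        ultimately show ?thesis
          by (subst q) (auto intro!: v_add_gt v_diff_gt simp: mult.commute)
      qed
      with less.prems(2) show False by (metis less_irrefl)
    qed
    have "degree q \<noteq> 0"
    proof
      assume "degree q = 0"
      then have "r = 0" by (simp add: r_def synthetic_div_eq_0_iff)
      with r_unit show False by (metis coeff_0 v_eq_Pinf one_neq_zero v_zero)
    qed
    then have "finite {y \<in> Y. v 1 < v (poly r y)}"
      using r_V r_unit by (intro less.hyps) (simp_all add: r_def degree_synthetic_div)
    moreover have "{y \<in> Y. v 1 < v (poly q y)} \<subseteq> insert y {y \<in> Y. v 1 < v (poly r y)}"
    proof
      fix x assume "x \<in> {y \<in> Y. v 1 < v (poly q y)}"
      then have x: "x \<in> Y" "v 1 < v (poly q x)" by auto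
      show "x \<in> insert y {y \<in> Y. v 1 < v (poly r y)}"
      proof (cases "x = y")
        case False
        then have unit: "v (x - y) = v 1"
          using assms(2) x y by blast
        \<comment> \<open>Since \<open>x - y\<close> is a unit, a residual root of \<open>q\<close>
          other than \<open>y\<close> is one of \<open>r\<close>.\<close>
        have "v 1 < v (poly q x - poly q y)"
          using x y by (intro v_diff_gt)
        also have "poly q x - poly q y = (x - y) * poly r x"
          using poly_q[of x] by simp
        also have "v \<dots> = v (1 * poly r x)"
          unfolding v_mult unit ..
        finally show ?thesis using x by simp
      qed simp
    qed
    ultimately show ?thesis
      by (metis finite_insert finite_subset)
  next
    case True
    then show ?thesis by (simp only: finite.emptyI)
  qed
qed

text \<open>Divided by \<open>c\<close>, the increments are residually distinct, so all but finitely
  many avoid the residual roots of the normalised polynomial. A given increment occurs at most once,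
  hence the exceptions disappear on a tail.\<close>

lemma regular_stationary:
  assumes idx: "index_set \<Lambda>" and c: "c \<noteq> 0"
    and diff: "\<And>\<nu> \<mu>. \<nu> \<in> \<Lambda> \<Longrightarrow> \<mu> \<in> \<Lambda> \<Longrightarrow> \<nu> \<noteq> \<mu> \<Longrightarrow> v (s \<nu> - s \<mu>) = v c"
    and sphere: "\<forall>\<^sub>F x in increments \<Lambda> s \<beta>. v x = v c"
  shows "\<forall>\<^sub>F x in increments \<Lambda> s \<beta>. regular p x"
proof (cases "p = 0")
  case True
  then show ?thesis by (simp add: regular_def)
next
  case False
  obtain k where "\<And>i. v (coeff p k * c ^ k) \<le> v (coeff p i * c ^ i)"
    using min_monomial by blast
  moreover define m where "m = coeff p k * c ^ k"
  ultimately have k: "v m \<le> v (coeff p i * c ^ i)" and k0: "m \<noteq> 0" for i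
    using min_monomial_nonzero[of p k c] False c by auto
  \<comment> \<open>Rescaling the variable by \<open>c\<close> and dividing by the least monomial at
    \<open>c\<close> puts all coefficients into \<open>V\<close> and makes the \<open>k\<close>-th
    equal to \<open>1\<close>.\<close>
  define q where "q = smult (inverse (m)) (pcompose p [:0, c:])"
  have coeff_q: "m * coeff q i = coeff p i * c ^ i" for i
    using k0 by (simp add: q_def coeff_pcompose_linear mult.commute)
  have poly_q: "m * poly q x = poly p (c * x)" for x
    using k0 by (simp add: q_def poly_pcompose mult.commute)
  define Y where "Y = {y. v y = v 1 \<and> (\<exists>\<nu>\<in>\<Lambda>. c * y = s \<nu> - \<beta>)}"
  have "finite {y \<in> Y. v 1 < v (poly q y)}"
  proof (rule finite_residual_roots)
    show "v 1 \<le> v y" if "y \<in> Y" for y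
      using that by (simp add: Y_def)
    show "v (y - y') = v 1" if yy: "y \<in> Y" "y' \<in> Y" "y \<noteq> y'" for y y'
    proof -
      obtain \<nu> \<nu>' where \<nu>: "\<nu> \<in> \<Lambda>" "c * y = s \<nu> - \<beta>" "\<nu>' \<in> \<Lambda>" "c * y' = s \<nu>' - \<beta>"
        using yy by (auto simp: Y_def)
      then have "\<nu> \<noteq> \<nu>'" using yy(3) c by (metis mult_left_cancel)
      moreover have "c * (y - y') = s \<nu> - s \<nu>'"
        using \<nu> by (simp add: right_diff_distrib)
      ultimately have "v (c * (y - y')) = v (c * 1)"
        using diff \<nu> by simp
      then show ?thesis using c v_mult_cancel_eq by blast
    qed
    have "v (m * 1) \<le> v (m * coeff q i)" for i
      using k by (simp add: coeff_q)
    then show "v 1 \<le> v (coeff q i)" for i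
      using k0 v_mult_cancel_le by blast
    have "coeff q k = 1"
      using coeff_q[of k] k0 by (simp flip: m_def)
    then show "\<exists>i. v (coeff q i) = v 1" by metis
  qed
  moreover have "\<forall>\<^sub>F x in increments \<Lambda> s \<beta>. x \<noteq> t" for t
  proof (cases "\<exists>\<nu>\<in>\<Lambda>. s \<nu> - \<beta> = t")
    case True
    then obtain \<nu> where \<nu>: "\<nu> \<in> \<Lambda>" "s \<nu> - \<beta> = t" by blast
    have "s \<rho> - \<beta> \<noteq> t" if "\<rho> \<in> \<Lambda> \<and> \<nu> < \<rho>" for \<rho>
    proof
      assume "s \<rho> - \<beta> = t"
      then have "s \<rho> - s \<nu> = 0" using \<nu> by auto
      with diff[of \<rho> \<nu>] that \<nu> c show False
        by (metis less_irrefl v_eq_Pinf v_zero)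
    qed
    then show ?thesis
      unfolding increments_def eventually_filtermap
      by (rule eventually_mono[OF eventually_tail_filter_gt[OF idx \<nu>(1)]])
  next
    case False
    then show ?thesis
      using idx by (auto simp: eventually_increments suff_large_def index_set_def)
  qed
  ultimately have "\<forall>\<^sub>F x in increments \<Lambda> s \<beta>. \<forall>y\<in>{y \<in> Y. v 1 < v (poly q y)}. x \<noteq> c * y"
    by (intro eventually_ball_finite) auto
  moreover have "\<forall>\<^sub>F x in increments \<Lambda> s \<beta>. \<exists>\<nu>\<in>\<Lambda>. x = s \<nu> - \<beta>"
    using idx by (auto simp: eventually_increments suff_large_def index_set_def)
  ultimately show ?thesis
    using sphere
  proof eventually_elim
    case (elim x)
    define y where "y = x / c"
    have x: "x = c * y" using c by (simp add: y_def)
    have "v (c * y) = v (c * 1)"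
      using elim x by simp
    then have "v y = v 1"
      using c v_mult_cancel_eq by blast
    then have "y \<in> Y"
      using elim x by (auto simp: Y_def)
    then have "v (poly q y) \<le> v 1"
      using elim x by (auto simp: not_less)
    then have "v (m * poly q y) \<le> v (m * 1)"
      using k0 v_mult_cancel_le by blast
    then have "v (poly p x) \<le> v (m)"
      by (simp add: poly_q x)
    moreover have "v (coeff p i * x ^ i) = v (coeff p i * c ^ i)" for i
      using v_power_eq[of x c i] elim by (simp add: v_mult)
    ultimately show ?case
      unfolding regular_def using k by (auto intro: order_trans)
  qed
qed

section \<open>Pseudo-monotone sequences\<close>

lemma gauge_convergent:
  assumes conv: "pseudo_convergent v \<Lambda> s" and \<nu>: "\<nu> \<in> \<Lambda>" "\<rho> \<in> \<Lambda>" "\<nu> < \<rho>"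
  shows "gauge v \<Lambda> s \<nu> = v (s \<rho> - s \<nu>)"
proof -
  \<comment> \<open>Here \<open>s \<sigma> - s \<nu>\<close> is the sum of
    \<open>s \<tau> - s \<nu>\<close> and \<open>s \<sigma> - s \<tau>\<close>, the second of
    strictly larger value.\<close>
  have step: "v (s \<sigma> - s \<nu>) = v (s \<tau> - s \<nu>)" if "\<tau> \<in> \<Lambda>" "\<sigma> \<in> \<Lambda>" "\<nu> < \<tau>" "\<tau> < \<sigma>" for \<tau> \<sigma>
  proof -
    have "v (s \<tau> - s \<nu>) < v (s \<sigma> - s \<tau>)"
      using conv that \<nu>(1) by (auto simp: pseudo_convergent_def)
    then show ?thesis
      using v_add_eq[of "s \<tau> - s \<nu>" "s \<sigma> - s \<tau>"] by simp
  qed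
  have "v (s \<sigma> - s \<nu>) = v (s \<rho> - s \<nu>)" if "\<sigma> \<in> \<Lambda>" "\<nu> < \<sigma>" for \<sigma>
    using step[of \<sigma> \<rho>] step[of \<rho> \<sigma>] that \<nu> by (cases \<sigma> \<rho> rule: linorder_cases) auto
  then have "(THE \<delta>. \<forall>\<rho>\<in>\<Lambda>. \<nu> < \<rho> \<longrightarrow> v (s \<rho> - s \<nu>) = \<delta>) = v (s \<rho> - s \<nu>)"
    using \<nu> by (intro the_equality) blast+
  with conv show ?thesis by (simp add: gauge_def)
qed

lemma gauge_convergent_strict:
  assumes conv: "pseudo_convergent v \<Lambda> s" and "\<nu> \<in> \<Lambda>" "\<rho> \<in> \<Lambda>" "\<nu> < \<rho>"
  shows "gauge v \<Lambda> s \<nu> < gauge v \<Lambda> s \<rho>"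
proof -
  obtain \<sigma> where "\<sigma> \<in> \<Lambda>" "\<rho> < \<sigma>"
    using conv assms(3) unfolding pseudo_convergent_def index_set_def by blast
  then show ?thesis
    using assms gauge_convergent[OF conv, of \<nu> \<rho>] gauge_convergent[OF conv, of \<rho> \<sigma>]
    by (auto simp: pseudo_convergent_def)
qed

lemma index_set_three:
  assumes "index_set \<Lambda>"
  obtains \<nu> \<rho> \<sigma> where "\<nu> \<in> \<Lambda>" "\<rho> \<in> \<Lambda>" "\<sigma> \<in> \<Lambda>" "\<nu> < \<rho>" "\<rho> < \<sigma>"
  using assms unfolding index_set_def by blast

text \<open>\<open>gauge\<close> tests the three kinds in turn; exclusivity ensures that it takes
  the intended branch.\<close>

lemma divergent_not_convergent:
  assumes "pseudo_divergent v \<Lambda> s"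
  shows "\<not> pseudo_convergent v \<Lambda> s"
proof -
  obtain \<nu> \<rho> \<sigma> where "\<nu> \<in> \<Lambda>" "\<rho> \<in> \<Lambda>" "\<sigma> \<in> \<Lambda>" "\<nu> < \<rho>" "\<rho> < \<sigma>"
    using assms index_set_three unfolding pseudo_divergent_def by metis
  with assms show ?thesis
    unfolding pseudo_divergent_def pseudo_convergent_def by (meson less_asym)
qed

lemma stationary_not_strict:
  assumes "pseudo_stationary v \<Lambda> s"
  shows "\<not> pseudo_convergent v \<Lambda> s" "\<not> pseudo_divergent v \<Lambda> s"
proof -
  obtain \<nu> \<rho> \<sigma> where *: "\<nu> \<in> \<Lambda>" "\<rho> \<in> \<Lambda>" "\<sigma> \<in> \<Lambda>" "\<nu> < \<rho>" "\<rho> < \<sigma>"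
    using assms index_set_three unfolding pseudo_stationary_def by metis
  then have "v (s \<rho> - s \<nu>) = v (s \<sigma> - s \<rho>)"
    using assms unfolding pseudo_stationary_def by (metis less_irrefl)
  with * show "\<not> pseudo_convergent v \<Lambda> s" "\<not> pseudo_divergent v \<Lambda> s"
    unfolding pseudo_divergent_def pseudo_convergent_def by (metis less_irrefl)+
qed

lemma gauge_divergent:
  assumes div: "pseudo_divergent v \<Lambda> s" and \<nu>: "\<nu> \<in> \<Lambda>" "\<rho> \<in> \<Lambda>" "\<rho> < \<nu>"
  shows "gauge v \<Lambda> s \<nu> = v (s \<rho> - s \<nu>)"
proof -
  have step: "v (s \<sigma> - s \<nu>) = v (s \<tau> - s \<nu>)" if "\<tau> \<in> \<Lambda>" "\<sigma> \<in> \<Lambda>" "\<sigma> < \<tau>" "\<tau> < \<nu>" for \<tau> \<sigma>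
  proof -
    have "v (s \<nu> - s \<tau>) < v (s \<tau> - s \<sigma>)"
      using div that \<nu>(1) by (auto simp: pseudo_divergent_def)
    then show ?thesis
      using v_add_eq[of "s \<nu> - s \<tau>" "s \<tau> - s \<sigma>"] by (simp add: v_minus_commute)
  qed
  have "v (s \<sigma> - s \<nu>) = v (s \<rho> - s \<nu>)" if "\<sigma> \<in> \<Lambda>" "\<sigma> < \<nu>" for \<sigma>
    using step[of \<sigma> \<rho>] step[of \<rho> \<sigma>] that \<nu> by (cases \<sigma> \<rho> rule: linorder_cases) auto
  then have "(THE \<delta>. \<forall>\<rho>\<in>\<Lambda>. \<rho> < \<nu> \<longrightarrow> v (s \<rho> - s \<nu>) = \<delta>) = v (s \<rho> - s \<nu>)"
    using \<nu> by (intro the_equality) blast+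
  with div divergent_not_convergent[OF div] show ?thesis by (simp add: gauge_def)
qed

text \<open>The index \<mu> below \<nu> is there because the gauge is unspecified at the minimum of
  \<Lambda>.\<close>

lemma gauge_divergent_strict:
  assumes div: "pseudo_divergent v \<Lambda> s" and "\<mu> \<in> \<Lambda>" "\<nu> \<in> \<Lambda>" "\<rho> \<in> \<Lambda>" "\<mu> < \<nu>" "\<nu> < \<rho>"
  shows "gauge v \<Lambda> s \<rho> < gauge v \<Lambda> s \<nu>"
  using assms gauge_divergent[OF div, of \<nu> \<mu>] gauge_divergent[OF div, of \<rho> \<nu>]
  by (auto simp: pseudo_divergent_def v_minus_commute)

lemma gauge_stationary:
  assumes stat: "pseudo_stationary v \<Lambda> s" and "\<rho> \<in> \<Lambda>" "\<mu> \<in> \<Lambda>" "\<rho> \<noteq> \<mu>"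
  shows "gauge v \<Lambda> s \<nu> = v (s \<rho> - s \<mu>)"
proof -
  have "v (s \<sigma> - s \<tau>) = v (s \<rho> - s \<mu>)" if "\<sigma> \<in> \<Lambda>" "\<tau> \<in> \<Lambda>" "\<sigma> \<noteq> \<tau>" for \<sigma> \<tau>
    using stat assms that unfolding pseudo_stationary_def by blast
  then have "(THE \<delta>. \<forall>\<rho>\<in>\<Lambda>. \<forall>\<mu>\<in>\<Lambda>. \<rho> \<noteq> \<mu> \<longrightarrow> v (s \<rho> - s \<mu>) = \<delta>) = v (s \<rho> - s \<mu>)"
    using assms by (intro the_equality) blast+
  with stat stationary_not_strict[OF stat] show ?thesis by (simp add: gauge_def)
qed

lemma pseudo_limits_iff:
  assumes "index_set \<Lambda>"
  shows "\<beta> \<in> pseudo_limits v \<Lambda> s \<longleftrightarrow>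
    (\<forall>\<^sub>F \<nu> in tail_filter \<Lambda>. v (s \<nu> - \<beta>) = gauge v \<Lambda> s \<nu>)"
  using assms
  by (simp add: pseudo_limits_def eventually_tail_filter index_set_def v_minus_commute)

lemma eventually_tail_filterE:
  assumes "index_set \<Lambda>" "eventually P (tail_filter \<Lambda>)"
  obtains \<nu> where "\<nu> \<in> \<Lambda>" "P \<nu>"
  using assms by (auto simp: eventually_tail_filter index_set_def suff_large_def)

text \<open>The gauge is the value of the increments. It cannot exceed \<open>v c\<close>, as
  \<beta> and \<open>\<beta> + c\<close> are both pseudo-limits, and it comes arbitrarily close to
  \<open>v c\<close>, as otherwise some element outside the ball would be a pseudo-limit.\<close>

lemma convergent_increments:
  assumes conv: "pseudo_convergent v \<Lambda> s" and c: "c \<noteq> 0"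
    and lim: "pseudo_limits v \<Lambda> s = affine \<alpha> c V" and \<beta>: "\<beta> \<in> affine \<alpha> c V"
  shows "\<forall>\<^sub>F x in increments \<Lambda> s \<beta>. v x < v c" "near c (increments \<Lambda> s \<beta>)"
proof -
  have idx: "index_set \<Lambda>" using conv by (simp add: pseudo_convergent_def)
  let ?g = "gauge v \<Lambda> s"
  have ev\<beta>: "\<forall>\<^sub>F \<nu> in tail_filter \<Lambda>. v (s \<nu> - \<beta>) = ?g \<nu>"
    using \<beta> lim pseudo_limits_iff[OF idx] by blast
  have "v c \<le> v (\<beta> + c - \<alpha>)"
    using \<beta> c v_add_ge[of "v c" "\<beta> - \<alpha>" c] by (simp add: affine_V_iff algebra_simps)
  then have "\<forall>\<^sub>F \<nu> in tail_filter \<Lambda>. v (s \<nu> - (\<beta> + c)) = ?g \<nu>"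
    using lim c affine_V_iff pseudo_limits_iff[OF idx] by blast
  with ev\<beta> have le: "\<forall>\<^sub>F \<nu> in tail_filter \<Lambda>. ?g \<nu> \<le> v c"
  proof eventually_elim
    case (elim \<nu>)
    have "?g \<nu> \<le> v (s \<nu> - \<beta> - (s \<nu> - (\<beta> + c)))"
      by (rule v_diff_ge) (simp_all add: elim)
    then show ?case by simp
  qed
  \<comment> \<open>A strictly increasing gauge that is eventually at most \<open>v c\<close> never
    attains it.\<close>
  have g_less: "?g \<nu> < v c" if \<nu>: "\<nu> \<in> \<Lambda>" for \<nu>
  proof -
    obtain \<rho> where "\<rho> \<in> \<Lambda> \<and> \<nu> < \<rho>" "?g \<rho> \<le> v c"
      using eventually_tail_filterE[OF idx eventually_conj[OF eventually_tail_filter_gt[OF idx \<nu>] le]]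
      by blast
    with gauge_convergent_strict[OF conv \<nu>, of \<rho>] show ?thesis by auto
  qed
  obtain \<nu>\<^sub>0 where \<nu>\<^sub>0: "\<nu>\<^sub>0 \<in> \<Lambda>" using idx by (auto simp: index_set_def)
  show below: "\<forall>\<^sub>F x in increments \<Lambda> s \<beta>. v x < v c"
    unfolding increments_def eventually_filtermap
    using ev\<beta> eventually_tail_filter_gt[OF idx \<nu>\<^sub>0]
    by eventually_elim (simp add: g_less)
  have above: "\<forall>\<^sub>F x in increments \<Lambda> s \<beta>. v c < v (e * x)" if e: "e \<noteq> 0" "v 1 < v e" for e
  proof -
    \<comment> \<open>Were the gauge always below \<open>v (c / e)\<close>, adding
      \<open>c / e\<close> to \<beta> would keep it a pseudo-limit, yet \<open>c / e\<close> has
      value less than \<open>v c\<close>.\<close>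
    have "\<exists>\<nu>\<in>\<Lambda>. v (c / e) \<le> ?g \<nu>"
    proof (rule ccontr)
      assume "\<not> ?thesis"
      then have small: "?g \<nu> < v (c / e)" if "\<nu> \<in> \<Lambda>" for \<nu>
        using that by (auto simp: not_le)
      have "\<forall>\<^sub>F \<nu> in tail_filter \<Lambda>. v (s \<nu> - (\<beta> + c / e)) = ?g \<nu>"
        using ev\<beta> eventually_tail_filter_gt[OF idx \<nu>\<^sub>0]
      proof eventually_elim
        case (elim \<nu>)
        then show ?case
          using v_add_eq[of "s \<nu> - \<beta>" "- (c / e)"] small[of \<nu>] by (simp add: diff_diff_add)
      qed
      then have "v c \<le> v (\<beta> + c / e - \<alpha>)"
        using lim c affine_V_iff pseudo_limits_iff[OF idx] by blast
      moreover have "v c \<le> v (\<beta> - \<alpha>)"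
        using \<beta> c by (simp add: affine_V_iff)
      ultimately have "v c \<le> v (\<beta> + c / e - \<alpha> - (\<beta> - \<alpha>))"
        by (rule v_diff_ge)
      then have "v (c / e * e) \<le> v (c / e * 1)"
        using e by simp
      then have "v e \<le> v 1"
        using c e by (subst (asm) v_mult_cancel_le) auto
      with e show False by auto
    qed
    then obtain \<nu>\<^sub>1 where \<nu>\<^sub>1: "\<nu>\<^sub>1 \<in> \<Lambda>" "v (c / e) \<le> ?g \<nu>\<^sub>1" by blast
    show ?thesis
      unfolding increments_def eventually_filtermap
      using ev\<beta> eventually_tail_filter_gt[OF idx \<nu>\<^sub>1(1)]
    proof eventually_elim
      case (elim \<nu>)
      then have "v (c / e) < v (s \<nu> - \<beta>)"
        using gauge_convergent_strict[OF conv \<nu>\<^sub>1(1), of \<nu>] \<nu>\<^sub>1 by auto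
      then have "v (e * (c / e)) < v (e * (s \<nu> - \<beta>))"
        using e v_mult_cancel_less by blast
      then show ?case using e by simp
    qed
  qed
  show "near c (increments \<Lambda> s \<beta>)"
    unfolding near_def
  proof (intro conjI allI impI)
    show "\<forall>\<^sub>F x in increments \<Lambda> s \<beta>. v x \<noteq> v c"
      using below by (rule eventually_mono) simp
    fix e assume e: "e \<noteq> 0" "v 1 < v e"
    have ec: "v (1 * c) < v (e * c)"
      using e c by (intro v_mult_strict) auto
    show "\<forall>\<^sub>F x in increments \<Lambda> s \<beta>. v c < v (e * x) \<and> v x < v (e * c)"
      using above[OF e] below by eventually_elim (use ec in auto)
  qed
qed

text \<open>The dual argument: \<open>z + c\<close> is not a pseudo-limit, which keeps the gauge
  above \<open>v c\<close>; \<open>z + e * c\<close> is one, which pushes the gauge down to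
  \<open>v (e * c)\<close>.\<close>

lemma divergent_increments:
  assumes div: "pseudo_divergent v \<Lambda> s" and c: "c \<noteq> 0"
    and lim: "pseudo_limits v \<Lambda> s = affine z c (max_ideal V)"
  shows "increments \<Lambda> s z \<le> annulus c"
proof (rule le_annulusI)
  fix e assume e: "e \<noteq> 0" "v 1 < v e"
  have idx: "index_set \<Lambda>" using div by (simp add: pseudo_divergent_def)
  let ?g = "gauge v \<Lambda> s"
  have limit_iff: "(\<forall>\<^sub>F \<nu> in tail_filter \<Lambda>. v (s \<nu> - y) = ?g \<nu>) \<longleftrightarrow> v c < v (y - z)" for y
    using lim c affine_max_ideal_iff pseudo_limits_iff[OF idx] by blast
  have evz: "\<forall>\<^sub>F \<nu> in tail_filter \<Lambda>. v (s \<nu> - z) = ?g \<nu>"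
    using limit_iff[of z] c by simp
  \<comment> \<open>All later indices lie above \<mu>, away from the minimum where the gauge is
    unspecified.\<close>
  obtain \<mu> where \<mu>: "\<mu> \<in> \<Lambda>" using idx by (auto simp: index_set_def)
  have g_greater: "v c < ?g \<nu>" if \<nu>: "\<nu> \<in> \<Lambda>" "\<mu> < \<nu>" for \<nu>
  proof (rule ccontr)
    assume "\<not> ?thesis"
    then have le: "?g \<nu> \<le> v c" by simp
    have "\<forall>\<^sub>F \<rho> in tail_filter \<Lambda>. v (s \<rho> - (z + c)) = ?g \<rho>"
      using evz eventually_tail_filter_gt[OF idx \<nu>(1)]
    proof eventually_elim
      case (elim \<rho>)
      then have "v (s \<rho> - z) < v (- c)"
        using gauge_divergent_strict[OF div \<mu> \<nu>(1), of \<rho>] \<nu> le by auto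
      then show ?case
        using v_add_eq[of "s \<rho> - z" "- c"] elim by (simp add: diff_diff_add)
    qed
    with limit_iff[of "z + c"] show False by simp
  qed
  have "v (1 * c) < v (e * c)"
    using e c by (intro v_mult_strict) auto
  then have "\<forall>\<^sub>F \<nu> in tail_filter \<Lambda>. v (s \<nu> - (z + e * c)) = ?g \<nu>"
    by (simp add: limit_iff)
  with evz have le: "\<forall>\<^sub>F \<nu> in tail_filter \<Lambda>. ?g \<nu> \<le> v (e * c)"
  proof eventually_elim
    case (elim \<nu>)
    have "?g \<nu> \<le> v (s \<nu> - z - (s \<nu> - (z + e * c)))"
      by (rule v_diff_ge) (simp_all add: elim)
    then show ?case by simp
  qed
  obtain \<nu> where \<nu>: "\<nu> \<in> \<Lambda>" "\<mu> < \<nu>" "?g \<nu> \<le> v (e * c)"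
    using eventually_tail_filterE[OF idx eventually_conj[OF eventually_tail_filter_gt[OF idx \<mu>] le]]
    by blast
  show "\<forall>\<^sub>F x in increments \<Lambda> s z. v c < v x \<and> v x < v (e * c)"
    unfolding increments_def eventually_filtermap
    using evz eventually_tail_filter_gt[OF idx \<nu>(1)]
  proof eventually_elim
    case (elim \<rho>)
    then show ?case
      using gauge_divergent_strict[OF div \<mu> \<nu>(1), of \<rho>] g_greater[of \<rho>] \<nu> by auto
  qed
qed

lemma stationary_increments:
  assumes stat: "pseudo_stationary v \<Lambda> s" and c: "c \<noteq> 0"
    and lim: "pseudo_limits v \<Lambda> s = affine \<alpha> c V" and \<beta>: "\<beta> \<in> affine \<alpha> c V"
  shows "\<forall>\<^sub>F x in increments \<Lambda> s \<beta>. v x = v c" "\<forall>\<^sub>F x in increments \<Lambda> s \<beta>. regular p x"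
proof -
  have idx: "index_set \<Lambda>" using stat by (simp add: pseudo_stationary_def)
  obtain \<nu> \<rho> where \<nu>\<rho>: "\<nu> \<in> \<Lambda>" "\<rho> \<in> \<Lambda>" "\<nu> \<noteq> \<rho>"
    using index_set_three[OF idx] by (metis less_irrefl)
  define g where "g = v (s \<nu> - s \<rho>)"
  have g: "gauge v \<Lambda> s \<sigma> = g" for \<sigma>
    unfolding g_def using gauge_stationary[OF stat] \<nu>\<rho> by blast
  have diff: "v (s \<mu> - s \<sigma>) = g" if "\<mu> \<in> \<Lambda>" "\<sigma> \<in> \<Lambda>" "\<mu> \<noteq> \<sigma>" for \<mu> \<sigma>
    using gauge_stationary[OF stat, of \<mu> \<sigma> \<mu>] that g by simp
  have limit_iff: "(\<forall>\<^sub>F \<nu> in tail_filter \<Lambda>. v (s \<nu> - y) = g) \<longleftrightarrow> v c \<le> v (y - \<alpha>)" for y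
    using lim c affine_V_iff pseudo_limits_iff[OF idx, of y s] by (simp add: g)
  \<comment> \<open>Each term of a pseudo-stationary sequence is itself a pseudo-limit, so
    differences of terms have value at least \<open>v c\<close>.\<close>
  have "v c \<le> v (s \<mu> - \<alpha>)" if \<mu>: "\<mu> \<in> \<Lambda>" for \<mu>
  proof -
    have "\<forall>\<^sub>F \<sigma> in tail_filter \<Lambda>. v (s \<sigma> - s \<mu>) = g"
      using eventually_tail_filter_gt[OF idx \<mu>]
      by (rule eventually_mono) (use diff \<mu> in auto)
    then show ?thesis by (simp add: limit_iff)
  qed
  then have "v c \<le> v (s \<nu> - \<alpha> - (s \<rho> - \<alpha>))"
    using \<nu>\<rho> by (simp only: v_diff_ge)
  then have "v c \<le> g" by (simp add: g_def)
  \<comment> \<open>The pseudo-limits \<alpha> and \<open>\<alpha> + c\<close> differ by exactly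
    \<open>c\<close>.\<close>
  moreover have "g \<le> v c"
  proof -
    have "\<forall>\<^sub>F \<sigma> in tail_filter \<Lambda>. v (s \<sigma> - \<alpha>) = g" "\<forall>\<^sub>F \<sigma> in tail_filter \<Lambda>. v (s \<sigma> - (\<alpha> + c)) = g"
      by (simp_all add: limit_iff)
    then have "\<forall>\<^sub>F \<sigma> in tail_filter \<Lambda>. v (s \<sigma> - \<alpha>) = g \<and> v (s \<sigma> - (\<alpha> + c)) = g"
      by (rule eventually_conj)
    then obtain \<sigma> where "v (s \<sigma> - \<alpha>) = g" "v (s \<sigma> - (\<alpha> + c)) = g"
      using eventually_tail_filterE[OF idx] by blast
    then have "g \<le> v (s \<sigma> - \<alpha> - (s \<sigma> - (\<alpha> + c)))"
      by (simp only: v_diff_ge)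
    then show ?thesis by simp
  qed
  ultimately have g_eq: "g = v c" by simp
  have "v c \<le> v (\<beta> - \<alpha>)"
    using \<beta> c by (simp add: affine_V_iff)
  then show sphere: "\<forall>\<^sub>F x in increments \<Lambda> s \<beta>. v x = v c"
    using limit_iff[of \<beta>] by (simp add: increments_def eventually_filtermap g_eq)
  show "\<forall>\<^sub>F x in increments \<Lambda> s \<beta>. regular p x"
    using regular_stationary[OF idx c _ sphere] diff g_eq by blast
qed

end

section \<open>Strict inclusions and equality of the rings\<close>

theorem proposition7p1:
  fixes V :: "'k::field set"
    and v :: "'k \<Rightarrow> 'g::linordered_ab_group_add extended"
    and \<alpha> c :: 'k and \<delta> :: 'g
    and \<Lambda>E :: "'i::wellorder set" and E :: "'i \<Rightarrow> 'k"
    and \<Lambda>F :: "'j::wellorder set" and F :: "'j \<Rightarrow> 'k"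
    and \<Lambda>D :: "'k \<Rightarrow> 'l::wellorder set" and D :: "'k \<Rightarrow> 'l \<Rightarrow> 'k"
    and z w :: 'k
  assumes "valuation_domain V"
    and "valuation_of V v"
    and "\<not> finitely_generated_ideal V (max_ideal V)"
    and "infinite (residue_field V)"
    and "c \<noteq> 0" and "v c = Fin \<delta>"
    and "pseudo_convergent v \<Lambda>E E" and "pseudo_limits v \<Lambda>E E = affine \<alpha> c V"
    and "pseudo_stationary v \<Lambda>F F" and "pseudo_limits v \<Lambda>F F = affine \<alpha> c V"
    and "\<And>y. y \<in> vball v \<alpha> \<delta> \<Longrightarrow> pseudo_divergent v (\<Lambda>D y) (D y)"
    and "\<And>y. y \<in> vball v \<alpha> \<delta> \<Longrightarrow> pseudo_limits v (\<Lambda>D y) (D y) = affine y c (max_ideal V)"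
    and "z \<in> vball v \<alpha> \<delta>" and "w \<in> vball v \<alpha> \<delta>"
  shows "seq_ring V \<Lambda>E E \<subset> seq_ring V \<Lambda>F F
    \<and> seq_ring V (\<Lambda>D z) (D z) \<subset> seq_ring V \<Lambda>F F
    \<and> seq_ring V \<Lambda>E E \<noteq> seq_ring V (\<Lambda>D z) (D z)
    \<and> (seq_ring V (\<Lambda>D z) (D z) = seq_ring V (\<Lambda>D w) (D w) \<longleftrightarrow> z - w \<in> scaled c (max_ideal V))"
proof -
  interpret valued_field V v using assms(2) by unfold_locales
  note fg = assms(3) and c = assms(5)
  have ball: "vball v \<alpha> \<delta> = affine \<alpha> c V"
    using affine_eq_vball[OF assms(2,6)] by simp
  have \<alpha>: "\<alpha> \<in> affine \<alpha> c V"
    using c by (simp add: affine_V_iff)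
  have z: "z \<in> affine \<alpha> c V" and w: "w \<in> affine \<alpha> c V"
    using assms(13,14) ball by auto
  have idxE: "index_set \<Lambda>E" and idxF: "index_set \<Lambda>F"
    using assms(7,9) by (auto simp: pseudo_convergent_def pseudo_stationary_def)
  have div: "pseudo_divergent v (\<Lambda>D y) (D y)" if "y \<in> affine \<alpha> c V" for y
    using assms(11) that ball by simp
  have idxD: "index_set (\<Lambda>D y)" if "y \<in> affine \<alpha> c V" for y
    using div[OF that] by (simp add: pseudo_divergent_def)
  have D_incr: "increments (\<Lambda>D y) (D y) y \<le> annulus c" if "y \<in> affine \<alpha> c V" for y
    using divergent_increments[OF div[OF that] c] assms(12) that ball by simp
  note D_near = near_annulus[OF fg D_incr]
  note E_incr = convergent_increments[OF assms(7) c assms(8) \<alpha>]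
  note F_incr = stationary_increments[OF assms(9) c assms(10)]
  obtain e where e: "e \<noteq> 0" "v 1 < v e"
    using nontrivial[OF fg] by blast
  have D_above: "\<forall>\<^sub>F x in increments (\<Lambda>D y) (D y) y. v c < v x" if "y \<in> affine \<alpha> c V" for y
    using e by (intro filter_leD[OF D_incr[OF that]]) (auto simp: eventually_annulus[OF fg])

  let ?X = "Fract [:- \<alpha>, 1:] [:c:]" and ?Y = "Fract [:c:] [:- z, 1:]"
  have X_E: "?X \<notin> seq_ring V \<Lambda>E E"
    unfolding linear_in_seq_ring_iff[OF idxE c]
    using E_incr(1) by (intro increments_not_eventually[OF idxE]) (simp add: not_le)
  have X_F: "?X \<in> seq_ring V \<Lambda>F F"
    unfolding linear_in_seq_ring_iff[OF idxF c]
    using F_incr(1)[OF \<alpha>] by (rule eventually_mono) simp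
  \<comment> \<open>Recentring from \<alpha> to \<open>z\<close> adds \<open>z - \<alpha>\<close>,
    whose value is at least \<open>v c\<close>.\<close>
  have X_D: "?X \<in> seq_ring V (\<Lambda>D z) (D z)"
    unfolding linear_in_seq_ring_iff[OF idxD[OF z] c] eventually_increments_shift[of _ _ _ \<alpha> z]
    using D_above[OF z]
  proof (rule eventually_mono)
    fix x assume "v c < v x"
    then show "v c \<le> v (x + (z - \<alpha>))"
      using z c by (intro v_add_ge) (auto simp: affine_V_iff)
  qed
  have Y_F: "?Y \<in> seq_ring V \<Lambda>F F"
  proof (subst reciprocal_in_seq_ring_iff[OF idxF])
    show "\<forall>\<^sub>F x in increments \<Lambda>F F z. x \<noteq> 0"
      using F_incr(1)[OF z] by (rule eventually_mono) (use c in \<open>metis v_eq_Pinf\<close>)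
    show "\<forall>\<^sub>F x in increments \<Lambda>F F z. v x \<le> v c"
      using F_incr(1)[OF z] by (rule eventually_mono) simp
  qed
  have Y_D: "?Y \<notin> seq_ring V (\<Lambda>D z) (D z)"
    unfolding reciprocal_in_seq_ring_iff[OF idxD[OF z] near_nonzero[OF fg D_near[OF z]]]
    using D_above[OF z] by (intro increments_not_eventually[OF idxD[OF z]]) (simp add: not_le)

  have "seq_ring V \<Lambda>E E \<subseteq> seq_ring V \<Lambda>F F"
    by (rule seq_ring_near_subset[OF fg c idxE E_incr(2) idxF F_incr[OF \<alpha>]])
  then have "seq_ring V \<Lambda>E E \<subset> seq_ring V \<Lambda>F F"
    using X_E X_F by blast
  moreover have "seq_ring V (\<Lambda>D z) (D z) \<subseteq> seq_ring V \<Lambda>F F"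
    by (rule seq_ring_near_subset[OF fg c idxD[OF z] D_near[OF z] idxF F_incr[OF z]])
  then have "seq_ring V (\<Lambda>D z) (D z) \<subset> seq_ring V \<Lambda>F F"
    using Y_D Y_F by blast
  moreover have "seq_ring V \<Lambda>E E \<noteq> seq_ring V (\<Lambda>D z) (D z)"
    using X_E X_D by blast
  moreover have "seq_ring V (\<Lambda>D z) (D z) = seq_ring V (\<Lambda>D w) (D w) \<longleftrightarrow> z - w \<in> scaled c (max_ideal V)"
  proof
    assume zw: "z - w \<in> scaled c (max_ideal V)"
    then have zw': "v c < v (z - w)"
      using c by (simp add: scaled_max_ideal_iff)
    \<comment> \<open>The two cosets coincide, so \<open>z\<close> may serve as centre for
      \<open>D w\<close> too.\<close>
    have "affine w c (max_ideal V) = affine z c (max_ideal V)"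
    proof (rule set_eqI)
      fix x
      have "v c < v (x - w) \<longleftrightarrow> v c < v (x - z)"
        using v_add_gt[of "v c" "x - z" "z - w"] v_diff_gt[of "v c" "x - w" "z - w"] zw'
        by (auto simp: algebra_simps)
      then show "x \<in> affine w c (max_ideal V) \<longleftrightarrow> x \<in> affine z c (max_ideal V)"
        using c by (simp add: affine_max_ideal_iff)
    qed
    then have "pseudo_limits v (\<Lambda>D w) (D w) = affine z c (max_ideal V)"
      using assms(12,14) by simp
    then have "increments (\<Lambda>D w) (D w) z \<le> annulus c"
      by (rule divergent_increments[OF div[OF w] c])
    then show "seq_ring V (\<Lambda>D z) (D z) = seq_ring V (\<Lambda>D w) (D w)"
      by (rule seq_ring_annulus_eq[OF fg c idxD[OF z] D_incr[OF z] idxD[OF w]])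
  next
    assume eq: "seq_ring V (\<Lambda>D z) (D z) = seq_ring V (\<Lambda>D w) (D w)"
    show "z - w \<in> scaled c (max_ideal V)"
    proof (rule ccontr)
      assume "\<not> ?thesis"
      then have zw: "v (w - z) \<le> v c"
        using c by (simp add: scaled_max_ideal_iff v_minus_commute not_less)
      \<comment> \<open>Seen from \<open>z\<close>, the terms of \<open>D w\<close> keep the value
        of \<open>w - z\<close>, at most \<open>v c\<close>, since their increments at
        \<open>w\<close> have larger value. Hence \<open>?Y\<close> would lie in the ring of
        \<open>D w\<close>.\<close>
      have "\<forall>\<^sub>F x in increments (\<Lambda>D w) (D w) z. v x = v (w - z)"
        unfolding eventually_increments_shift[of _ _ _ z w]
        using D_above[OF w]
      proof (rule eventually_mono)
        fix x assume "v c < v x"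
        then show "v (x + (w - z)) = v (w - z)"
          using v_add_eq[of "w - z" x] zw by (simp add: add.commute)
      qed
      then have "\<forall>\<^sub>F x in increments (\<Lambda>D w) (D w) z. x \<noteq> 0 \<and> v x \<le> v c"
        by (rule eventually_mono) (use zw c in \<open>metis Pinf_le_v v_zero\<close>)
      then have "?Y \<in> seq_ring V (\<Lambda>D w) (D w)"
        by (subst reciprocal_in_seq_ring_iff[OF idxD[OF w]]) (auto elim: eventually_mono)
      with eq Y_D show False by simp
    qed
  qed
  ultimately show ?thesis by blast
qed

end
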